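(* Let $\Gamma$ be a discrete group, let $\mathcal{G}$ be a $\Gamma$-graded ample Hausdorff groupoid with grading cocycle $c:\mathcal{G}\to\Gamma$, and let $R$ be a unital commutative ring. Then there is an isomorphism of $\Gamma$-graded $R$-algebras $A_R(\mathcal{G}\times_c\Gamma)\cong A_R(\mathcal{G})\#\Gamma$ which maps $1_{U\times\{\alpha\}}$ to $1_U p_\alpha$ for each compact open bisection $U$ of $\mathcal{G}$ and each $\alpha\in\Gamma$.
   Context: For $x$ in a groupoid $\mathcal{G}$, $d(x)=x^{-1}x$ is the domain and $r(x)=xx^{-1}$ the range; $xy$ is defined iff $d(x)=r(y)$; $\mathcal{G}^{(0)}$ is the unit space. A topological groupoid is étale if $d$ is a local homeomorphism. An open bisection is an open $U\subseteq\mathcal{G}$ such that $d|_U$ and $r|_U$ are homeomorphisms onto open subsets of $\mathcal{G}^{(0)}$. $\mathcal{G}$ is ample if it is étale and its topology has a basis of compact open bisections. A $\Gamma$-grading of $\mathcal{G}$ is a continuous map (cocycle) $c:\mathcal{G}\to\Gamma$ with $c(xy)=c(x)c(y)$ for all composable $x,y$. The Steinberg algebra $A_R(\mathcal{G})$ is the $R$-module of functions $\mathcal{G}\to R$ spanned by the characteristic functions $1_U$ of compact open bisections $U$, with pointwise addition and convolution $(f*g)(z)=\sum_{xy=z}f(x)g(y)$. It is $\Gamma$-graded by $A_R(\mathcal{G})_\gamma=\{f:\operatorname{supp}(f)\subseteq c^{-1}(\gamma)\}$. The skew-product groupoid $\mathcal{G}\times_c\Gamma$ is the set $\mathcal{G}\times\Gamma$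 with the product topology, where $(x,\alpha)$ and $(y,\beta)$ are composable iff $x,y$ are composable and $\alpha=c(y)\beta$, with $(x,c(y)\beta)(y,\beta)=(xy,\beta)$ and $(x,\alpha)^{-1}=(x^{-1},c(x)\alpha)$. It is an ample Hausdorff groupoid, graded by $\tilde c(x,\gamma)=c(x)$, so $A_R(\mathcal{G}\times_c\Gamma)_\gamma=\{f:\operatorname{supp}(f)\subseteq c^{-1}(\gamma)\times\Gamma\}$. For a $\Gamma$-graded ring $A$ (possibly non-unital; $s_\gamma$ denotes the $\gamma$-component of $s\in A$), the smash product $A\#\Gamma$ is the ring of finite formal sums $\sum_{\gamma\in\Gamma}r^{(\gamma)}p_\gamma$, $r^{(\gamma)}\in A$, $p_\gamma$ formal symbols, with componentwise addition and multiplication extending $(rp_\alpha)(sp_\beta)=r\,s_{\alpha\beta^{-1}}\,p_\beta$. It is $\Gamma$-graded by $(A\#\Gamma)_\gamma=\sum_{\alpha\in\Gamma}A_\gamma p_\alpha$. *)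

theory Defs
  imports "HOL-Analysis.Analysis" "HOL-Algebra.Module"
begin

section \<open>Ample groupoids\<close>

text \<open>
  The underlying set of a groupoid is the topspace of its topology. The total functions
  \<open>gmult\<close> and \<open>ginv\<close> are only meaningful on composable pairs and on the underlying set,
  respectively.
\<close>

record 'g top_groupoid =
  gtop :: "'g topology"
  gcomposable :: "'g \<Rightarrow> 'g \<Rightarrow> bool"
  gmult :: "'g \<Rightarrow> 'g \<Rightarrow> 'g"
  ginv :: "'g \<Rightarrow> 'g"

definition gdom :: "('g, 'm) top_groupoid_scheme \<Rightarrow> 'g \<Rightarrow> 'g"
  where "gdom G x = gmult G (ginv G x) x"

definition gran :: "('g, 'm) top_groupoid_scheme \<Rightarrow> 'g \<Rightarrow> 'g"
  where "gran G x = gmult G x (ginv G x)"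

definition unit_space :: "('g, 'm) top_groupoid_scheme \<Rightarrow> 'g set"
  where "unit_space G = gdom G ` topspace (gtop G)"

locale topological_groupoid =
  fixes G :: "('g, 'm) top_groupoid_scheme" (structure)
  assumes composable_closed:
      "gcomposable G x y \<Longrightarrow> x \<in> topspace (gtop G) \<and> y \<in> topspace (gtop G)"
    and mult_closed: "gcomposable G x y \<Longrightarrow> gmult G x y \<in> topspace (gtop G)"
    and inv_closed: "x \<in> topspace (gtop G) \<Longrightarrow> ginv G x \<in> topspace (gtop G)"
    and composable_iff:
      "\<lbrakk>x \<in> topspace (gtop G); y \<in> topspace (gtop G)\<rbrakk>
        \<Longrightarrow> gcomposable G x y \<longleftrightarrow> gdom G x = gran G y"
    and assoc:
      "\<lbrakk>gcomposable G x y; gcomposable G y z\<rbrakk>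
        \<Longrightarrow> gcomposable G (gmult G x y) z \<and> gcomposable G x (gmult G y z)
          \<and> gmult G (gmult G x y) z = gmult G x (gmult G y z)"
    and inv_inv: "x \<in> topspace (gtop G) \<Longrightarrow> ginv G (ginv G x) = x"
    and inv_composable: "x \<in> topspace (gtop G) \<Longrightarrow> gcomposable G (ginv G x) x"
    and inv_mult_cancel: "gcomposable G x y \<Longrightarrow> gmult G (ginv G x) (gmult G x y) = y"
    and mult_inv_cancel: "gcomposable G x y \<Longrightarrow> gmult G (gmult G x y) (ginv G y) = x"
    and continuous_mult:
      "continuous_map
        (subtopology (prod_topology (gtop G) (gtop G)) {(x, y). gcomposable G x y})
        (gtop G) (\<lambda>(x, y). gmult G x y)"
    and continuous_inv: "continuous_map (gtop G) (gtop G) (ginv G)"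

definition local_homeomorphic_map :: "'a topology \<Rightarrow> 'b topology \<Rightarrow> ('a \<Rightarrow> 'b) \<Rightarrow> bool"
  where "local_homeomorphic_map S T f \<longleftrightarrow>
    (\<forall>x \<in> topspace S. \<exists>U. openin S U \<and> x \<in> U \<and> openin T (f ` U)
      \<and> homeomorphic_map (subtopology S U) (subtopology T (f ` U)) f)"

definition open_bisection :: "('g, 'm) top_groupoid_scheme \<Rightarrow> 'g set \<Rightarrow> bool"
  where "open_bisection G U \<longleftrightarrow>
    openin (gtop G) U
    \<and> (\<forall>f \<in> {gdom G, gran G}.
          openin (subtopology (gtop G) (unit_space G)) (f ` U)
          \<and> homeomorphic_map (subtopology (gtop G) U) (subtopology (gtop G) (f ` U)) f)"

definition compact_open_bisection :: "('g, 'm) top_groupoid_scheme \<Rightarrow> 'g set \<Rightarrow> bool"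
  where "compact_open_bisection G U \<longleftrightarrow> open_bisection G U \<and> compactin (gtop G) U"

locale etale_groupoid = topological_groupoid +
  assumes etale:
    "local_homeomorphic_map (gtop G) (subtopology (gtop G) (unit_space G)) (gdom G)"

locale ample_groupoid = etale_groupoid +
  assumes compact_open_bisection_basis:
    "openin (gtop G) V \<Longrightarrow>
      \<exists>\<U>. (\<forall>U \<in> \<U>. compact_open_bisection G U) \<and> V = \<Union>\<U>"

locale groupoid_grading = topological_groupoid G + group \<Gamma>
  for \<Gamma> :: "('h, 'n) monoid_scheme" and G :: "('g, 'm) top_groupoid_scheme"
    and c :: "'g \<Rightarrow> 'h" +
  assumes cocycle_continuous:
      "continuous_map (gtop G) (discrete_topology (carrier \<Gamma>)) c"
    and cocycle_mult:
      "gcomposable G x y \<Longrightarrow> c (gmult G x y) = c x \<otimes>\<^bsub>\<Gamma>\<^esub> c y"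

definition skew_product ::
    "('h, 'n) monoid_scheme \<Rightarrow> ('g, 'm) top_groupoid_scheme \<Rightarrow> ('g \<Rightarrow> 'h) \<Rightarrow> ('g \<times> 'h) top_groupoid"
  where "skew_product \<Gamma> G c =
    \<lparr> gtop = prod_topology (gtop G) (discrete_topology (carrier \<Gamma>)),
      gcomposable = (\<lambda>(x, \<alpha>) (y, \<beta>). gcomposable G x y
        \<and> \<alpha> \<in> carrier \<Gamma> \<and> \<beta> \<in> carrier \<Gamma> \<and> \<alpha> = c y \<otimes>\<^bsub>\<Gamma>\<^esub> \<beta>),
      gmult = (\<lambda>(x, \<alpha>) (y, \<beta>). (gmult G x y, \<beta>)),
      ginv = (\<lambda>(x, \<alpha>). (ginv G x, c x \<otimes>\<^bsub>\<Gamma>\<^esub> \<alpha>)) \<rparr>"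


section \<open>Algebras\<close>

text \<open>
  Algebras over a commutative ring, possibly without unit, are represented by the record type
  of modules, which also has a multiplication. As the algebras below have no unit in general,
  the \<open>one\<close> field is a dummy and plays no role. A \<open>\<Gamma>\<close>-grading of an algebra \<open>A\<close> is given by
  its homogeneous components, a family of subsets of \<open>carrier A\<close> indexed by \<open>\<Gamma>\<close>.
\<close>

inductive_set module_span ::
    "('r, 'n) ring_scheme \<Rightarrow> ('r, 'a, 'm) module_scheme \<Rightarrow> 'a set \<Rightarrow> 'a set"
  for R :: "('r, 'n) ring_scheme" and M :: "('r, 'a, 'm) module_scheme" and S :: "'a set"
  where
    zero: "\<zero>\<^bsub>M\<^esub> \<in> module_span R M S"
  | add_smult: "\<lbrakk>a \<in> carrier R; s \<in> S; v \<in> module_span R M S\<rbrakk>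
      \<Longrightarrow> (a \<odot>\<^bsub>M\<^esub> s) \<oplus>\<^bsub>M\<^esub> v \<in> module_span R M S"

definition graded_algebra_iso ::
    "('h, 'n) monoid_scheme \<Rightarrow> ('r, 'k) ring_scheme
      \<Rightarrow> ('r, 'a, 'm) module_scheme \<Rightarrow> ('h \<Rightarrow> 'a set)
      \<Rightarrow> ('r, 'b, 'l) module_scheme \<Rightarrow> ('h \<Rightarrow> 'b set) \<Rightarrow> ('a \<Rightarrow> 'b) \<Rightarrow> bool"
  where "graded_algebra_iso \<Gamma> R A \<A> B \<B> \<phi> \<longleftrightarrow>
    bij_betw \<phi> (carrier A) (carrier B)
    \<and> (\<forall>f \<in> carrier A. \<forall>g \<in> carrier A. \<phi> (f \<oplus>\<^bsub>A\<^esub> g) = \<phi> f \<oplus>\<^bsub>B\<^esub> \<phi> g)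
    \<and> (\<forall>f \<in> carrier A. \<forall>g \<in> carrier A. \<phi> (f \<otimes>\<^bsub>A\<^esub> g) = \<phi> f \<otimes>\<^bsub>B\<^esub> \<phi> g)
    \<and> (\<forall>a \<in> carrier R. \<forall>f \<in> carrier A. \<phi> (a \<odot>\<^bsub>A\<^esub> f) = a \<odot>\<^bsub>B\<^esub> \<phi> f)
    \<and> (\<forall>\<gamma> \<in> carrier \<Gamma>. \<phi> ` \<A> \<gamma> = \<B> \<gamma>)"


section \<open>Steinberg algebras\<close>

text \<open>
  Functions from \<open>\<G>\<close> to \<open>R\<close> are represented by functions that vanish off the
  underlying set of \<open>\<G>\<close>.
\<close>

definition char_fun :: "('r, 'n) ring_scheme \<Rightarrow> 'g set \<Rightarrow> 'g \<Rightarrow> 'r"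
  where "char_fun R U = (\<lambda>x. if x \<in> U then \<one>\<^bsub>R\<^esub> else \<zero>\<^bsub>R\<^esub>)"

text \<open>
  The sum over all factorisations \<open>x y = z\<close> is restricted to the nonzero terms
  because \<open>finsum\<close> is meaningful for finite index sets only.
\<close>

definition convolution ::
    "('r, 'n) ring_scheme \<Rightarrow> ('g, 'm) top_groupoid_scheme \<Rightarrow> ('g \<Rightarrow> 'r) \<Rightarrow> ('g \<Rightarrow> 'r) \<Rightarrow> 'g \<Rightarrow> 'r"
  where "convolution R G f g = (\<lambda>z.
    \<Oplus>\<^bsub>R\<^esub>p \<in> {(x, y). gcomposable G x y \<and> gmult G x y = z
        \<and> f x \<noteq> \<zero>\<^bsub>R\<^esub> \<and> g y \<noteq> \<zero>\<^bsub>R\<^esub>}. f (fst p) \<otimes>\<^bsub>R\<^esub> g (snd p))"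

definition function_algebra ::
    "('r, 'n) ring_scheme \<Rightarrow> ('g, 'm) top_groupoid_scheme \<Rightarrow> ('r, 'g \<Rightarrow> 'r) module"
  where "function_algebra R G =
    \<lparr> carrier = {f. (\<forall>x \<in> topspace (gtop G). f x \<in> carrier R)
        \<and> (\<forall>x. x \<notin> topspace (gtop G) \<longrightarrow> f x = \<zero>\<^bsub>R\<^esub>)},
      mult = convolution R G,
      one = undefined,
      zero = (\<lambda>x. \<zero>\<^bsub>R\<^esub>),
      add = (\<lambda>f g x. f x \<oplus>\<^bsub>R\<^esub> g x),
      smult = (\<lambda>a f x. a \<otimes>\<^bsub>R\<^esub> f x) \<rparr>"

definition steinberg_algebra ::
    "('r, 'n) ring_scheme \<Rightarrow> ('g, 'm) top_groupoid_scheme \<Rightarrow> ('r, 'g \<Rightarrow> 'r) module"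
  where "steinberg_algebra R G = (function_algebra R G)
    \<lparr> carrier := module_span R (function_algebra R G)
        {char_fun R U | U. compact_open_bisection G U} \<rparr>"

definition steinberg_grading ::
    "('r, 'n) ring_scheme \<Rightarrow> ('g, 'm) top_groupoid_scheme \<Rightarrow> ('g \<Rightarrow> 'h) \<Rightarrow> 'h \<Rightarrow> ('g \<Rightarrow> 'r) set"
  where "steinberg_grading R G c \<gamma> =
    {f \<in> carrier (steinberg_algebra R G).
      {x \<in> topspace (gtop G). f x \<noteq> \<zero>\<^bsub>R\<^esub>} \<subseteq> {x \<in> topspace (gtop G). c x = \<gamma>}}"


section \<open>Smash products\<close>

definition homogeneous_component ::
    "('h, 'n) monoid_scheme \<Rightarrow> ('a, 'm) ring_scheme \<Rightarrow> ('h \<Rightarrow> 'a set) \<Rightarrow> 'a \<Rightarrow> 'h \<Rightarrow> 'a"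
  where "homogeneous_component \<Gamma> A \<A> s =
    (THE u. (\<forall>\<gamma> \<in> carrier \<Gamma>. u \<gamma> \<in> \<A> \<gamma>) \<and> (\<forall>\<gamma>. \<gamma> \<notin> carrier \<Gamma> \<longrightarrow> u \<gamma> = \<zero>\<^bsub>A\<^esub>)
      \<and> finite {\<gamma>. u \<gamma> \<noteq> \<zero>\<^bsub>A\<^esub>} \<and> s = (\<Oplus>\<^bsub>A\<^esub>\<gamma> \<in> {\<gamma>. u \<gamma> \<noteq> \<zero>\<^bsub>A\<^esub>}. u \<gamma>))"

text \<open>
  The formal sum of the terms \<open>r \<gamma> p\<^sub>\<gamma>\<close> is represented by the finitely supported coefficient
  function \<open>r\<close>, which vanishes off \<open>\<Gamma>\<close>. Extending
  \<open>(a p\<^sub>\<alpha>) (b p\<^sub>\<beta>) = a b\<^bsub>\<alpha>\<beta>\<inverse>\<^esub> p\<^sub>\<beta>\<close> biadditively, the coefficient of \<open>p\<^sub>\<beta>\<close> in a product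
  \<open>r s\<close> is the sum over \<open>\<alpha>\<close> of the products of \<open>r \<alpha>\<close> with the component of \<open>s \<beta>\<close> of
  degree \<open>\<alpha>\<beta>\<inverse>\<close>.
\<close>

definition smash_product ::
    "('h, 'n) monoid_scheme \<Rightarrow> ('r, 'a, 'm) module_scheme \<Rightarrow> ('h \<Rightarrow> 'a set)
      \<Rightarrow> ('r, 'h \<Rightarrow> 'a) module"
  where "smash_product \<Gamma> A \<A> =
    \<lparr> carrier = {r. (\<forall>\<gamma> \<in> carrier \<Gamma>. r \<gamma> \<in> carrier A)
        \<and> (\<forall>\<gamma>. \<gamma> \<notin> carrier \<Gamma> \<longrightarrow> r \<gamma> = \<zero>\<^bsub>A\<^esub>) \<and> finite {\<gamma>. r \<gamma> \<noteq> \<zero>\<^bsub>A\<^esub>}},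
      mult = (\<lambda>r s \<beta>. if \<beta> \<in> carrier \<Gamma>
        then \<Oplus>\<^bsub>A\<^esub>\<alpha> \<in> {\<alpha>. r \<alpha> \<noteq> \<zero>\<^bsub>A\<^esub>}.
          r \<alpha> \<otimes>\<^bsub>A\<^esub> homogeneous_component \<Gamma> A \<A> (s \<beta>) (\<alpha> \<otimes>\<^bsub>\<Gamma>\<^esub> inv\<^bsub>\<Gamma>\<^esub> \<beta>)
        else \<zero>\<^bsub>A\<^esub>),
      one = undefined,
      zero = (\<lambda>\<gamma>. \<zero>\<^bsub>A\<^esub>),
      add = (\<lambda>r s \<gamma>. r \<gamma> \<oplus>\<^bsub>A\<^esub> s \<gamma>),
      smult = (\<lambda>a r \<gamma>. a \<odot>\<^bsub>A\<^esub> r \<gamma>) \<rparr>"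

text \<open>The monomial \<open>a p\<^sub>\<alpha>\<close>.\<close>

definition smash_monomial :: "('a, 'm) ring_scheme \<Rightarrow> 'a \<Rightarrow> 'h \<Rightarrow> 'h \<Rightarrow> 'a"
  where "smash_monomial A a \<alpha> = (\<lambda>\<gamma>. if \<gamma> = \<alpha> then a else \<zero>\<^bsub>A\<^esub>)"

definition smash_grading ::
    "('h, 'n) monoid_scheme \<Rightarrow> ('r, 'a, 'm) module_scheme \<Rightarrow> ('h \<Rightarrow> 'a set) \<Rightarrow> 'h \<Rightarrow> ('h \<Rightarrow> 'a) set"
  where "smash_grading \<Gamma> A \<A> \<gamma> =
    {r \<in> carrier (smash_product \<Gamma> A \<A>). \<forall>\<alpha> \<in> carrier \<Gamma>. r \<alpha> \<in> \<A> \<gamma>}"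

end

theory Submission
  imports Defs
begin

text \<open>
  The isomorphism sends \<open>f\<close> to its family of slices \<open>f (_, \<alpha>)\<close>, the slice at \<open>\<alpha>\<close> being the
  coefficient of \<open>p\<^sub>\<alpha>\<close>. A factorisation of \<open>(z, \<beta>)\<close> in the skew product is a factorisation
  \<open>z = x y\<close> in \<open>G\<close> together with the second coordinate \<open>c(y) \<beta>\<close> of the left factor, and
  \<open>\<alpha> = c(y) \<beta>\<close> says that \<open>y\<close> has degree \<open>\<alpha> \<beta>\<^sup>-\<^sup>1\<close>, so convolution turns into the
  multiplication of the smash product. Compactness makes the slices finite in number and lets
  each of them be cut into finitely many pieces that are homogeneous bisections.
\<close>

text \<open>Coefficients of a smash product are \<open>finsum\<close>s in the Steinberg algebra, and
  evaluating these pointwise requires their terms to lie in its carrier. So closure under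
  convolution has to be established; this is where the Hausdorff property enters, because it makes
  the composable pairs a closed set and hence the product of two compact bisections compact.
  Homogeneous components, being given by a definite description, also need existence and uniqueness.
  The skew product is not interpreted as a groupoid: its bisections are reached through explicit
  formulas for its domain and range maps, which is why the general facts on bisections and Steinberg
  functions concern a bare record \<open>H\<close>.\<close>

lemma (in abelian_monoid) finsum_swap:
  assumes "finite A" "finite B" "\<And>i j. i \<in> A \<Longrightarrow> j \<in> B \<Longrightarrow> f i j \<in> carrier G"
  shows "(\<Oplus>i\<in>A. \<Oplus>j\<in>B. f i j) = (\<Oplus>j\<in>B. \<Oplus>i\<in>A. f i j)"
  using assms(1,3)
proof (induction A)
  case (insert a A)
  have "(\<Oplus>j\<in>B. \<Oplus>i\<in>insert a A. f i j) = (\<Oplus>j\<in>B. f a j \<oplus> (\<Oplus>i\<in>A. f i j))"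
    using insert by (intro finsum_cong') (auto simp: Pi_def)
  also have "\<dots> = (\<Oplus>j\<in>B. f a j) \<oplus> (\<Oplus>j\<in>B. \<Oplus>i\<in>A. f i j)"
    using insert by (intro finsum_addf) (auto simp: Pi_def)
  finally show ?case
    using insert by (simp add: Pi_def)
qed simp

subsection \<open>The module of functions spanned by compact open bisections\<close>

lemma function_algebra_simps [simp]:
  "mult (function_algebra R H) = convolution R H"
  "zero (function_algebra R H) = (\<lambda>x. \<zero>\<^bsub>R\<^esub>)"
  "add (function_algebra R H) = (\<lambda>f g x. f x \<oplus>\<^bsub>R\<^esub> g x)"
  "smult (function_algebra R H) = (\<lambda>a f x. a \<otimes>\<^bsub>R\<^esub> f x)"
  by (simp_all add: function_algebra_def)

lemma steinberg_algebra_simps [simp]: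
  "mult (steinberg_algebra R H) = convolution R H"
  "zero (steinberg_algebra R H) = (\<lambda>x. \<zero>\<^bsub>R\<^esub>)"
  "add (steinberg_algebra R H) = (\<lambda>f g x. f x \<oplus>\<^bsub>R\<^esub> g x)"
  "smult (steinberg_algebra R H) = (\<lambda>a f x. a \<otimes>\<^bsub>R\<^esub> f x)"
  by (simp_all add: function_algebra_def steinberg_algebra_def)

lemma carrier_steinberg_algebra:
  "carrier (steinberg_algebra R H) =
    module_span R (function_algebra R H) {char_fun R U | U. compact_open_bisection H U}"
  by (simp add: steinberg_algebra_def)

lemma compact_open_bisectionD:
  assumes "compact_open_bisection H U"
  shows "openin (gtop H) U" "compactin (gtop H) U" "U \<subseteq> topspace (gtop H)"
    "inj_on (gdom H) U" "inj_on (gran H) U"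
proof -
  show *: "openin (gtop H) U" "compactin (gtop H) U"
    using assms by (simp_all add: compact_open_bisection_def open_bisection_def)
  then show "U \<subseteq> topspace (gtop H)"
    using openin_subset by blast
  then show "inj_on (gdom H) U" "inj_on (gran H) U"
    using assms by (simp_all add: compact_open_bisection_def open_bisection_def
        homeomorphic_eq_everything_map Int_absorb1)
qed

context cring
begin

lemma char_fun_closed [simp]: "char_fun R U x \<in> carrier R"
  by (simp add: char_fun_def)

lemma steinberg_zero: "(\<lambda>x. \<zero>) \<in> carrier (steinberg_algebra R H)"
  using module_span.zero[of "function_algebra R H" R]
  by (simp add: carrier_steinberg_algebra)

lemma steinberg_add_char:
  "\<lbrakk>a \<in> carrier R; compact_open_bisection H U; v \<in> carrier (steinberg_algebra R H)\<rbrakk>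
    \<Longrightarrow> (\<lambda>x. a \<otimes> char_fun R U x \<oplus> v x) \<in> carrier (steinberg_algebra R H)"
  using module_span.add_smult[of a R "char_fun R U"
      "{char_fun R U | U. compact_open_bisection H U}" v "function_algebra R H"]
  unfolding carrier_steinberg_algebra by auto

text \<open>The span grows by one multiple of a generator at a time, so closure and finiteness
  statements need only be checked for such an extension. Membership of \<open>v\<close> is kept in
  the step because pointwise ring identities need its values in the carrier.\<close>

lemma steinberg_induct [consumes 1, case_names zero add_char]:
  assumes "f \<in> carrier (steinberg_algebra R H)"
    and "P (\<lambda>x. \<zero>)"
    and "\<And>a U v. \<lbrakk>a \<in> carrier R; compact_open_bisection H U;
      v \<in> carrier (steinberg_algebra R H); P v\<rbrakk> \<Longrightarrow> P (\<lambda>x. a \<otimes> char_fun R U x \<oplus> v x)"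
  shows "P f"
  using assms(1) unfolding carrier_steinberg_algebra
proof (induction rule: module_span.induct)
  case zero
  then show ?case using assms(2) by simp
next
  case (add_smult a s v)
  then show ?case using assms(3) by (auto simp: carrier_steinberg_algebra)
qed

lemma steinberg_closed:
  "f \<in> carrier (steinberg_algebra R H) \<Longrightarrow> f x \<in> carrier R"
  by (induction rule: steinberg_induct) auto

lemma steinberg_outside:
  "f \<in> carrier (steinberg_algebra R H) \<Longrightarrow> x \<notin> topspace (gtop H) \<Longrightarrow> f x = \<zero>"
proof (induction rule: steinberg_induct)
  case (add_char a U v)
  then have "x \<notin> U" using compact_open_bisectionD(3) by blast
  with add_char show ?case by (simp add: char_fun_def)
qed simp

lemma steinberg_add:
  assumes "f \<in> carrier (steinberg_algebra R H)" "g \<in> carrier (steinberg_algebra R H)"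
  shows "(\<lambda>x. f x \<oplus> g x) \<in> carrier (steinberg_algebra R H)"
  using assms(1)
proof (induction rule: steinberg_induct)
  case (add_char a U v)
  have "(\<lambda>x. (a \<otimes> char_fun R U x \<oplus> v x) \<oplus> g x) = (\<lambda>x. a \<otimes> char_fun R U x \<oplus> (v x \<oplus> g x))"
    using add_char(1) steinberg_closed[OF add_char(3)] steinberg_closed[OF assms(2)]
    by (simp add: a_assoc)
  with steinberg_add_char[OF add_char(1,2,4)] show ?case by simp
qed (simp add: assms(2) steinberg_closed[OF assms(2)])

lemma steinberg_smult:
  assumes "a \<in> carrier R" "f \<in> carrier (steinberg_algebra R H)"
  shows "(\<lambda>x. a \<otimes> f x) \<in> carrier (steinberg_algebra R H)"
  using assms(2)
proof (induction rule: steinberg_induct)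
  case (add_char b U v)
  have "(\<lambda>x. a \<otimes> (b \<otimes> char_fun R U x \<oplus> v x)) = (\<lambda>x. (a \<otimes> b) \<otimes> char_fun R U x \<oplus> a \<otimes> v x)"
    using add_char(1) steinberg_closed[OF add_char(3)] assms(1)
    by (simp add: r_distr m_assoc)
  with steinberg_add_char[OF m_closed[OF assms(1) add_char(1)] add_char(2,4)] show ?case by simp
qed (use assms(1) steinberg_zero in simp)

lemma steinberg_char:
  "compact_open_bisection H U \<Longrightarrow> char_fun R U \<in> carrier (steinberg_algebra R H)"
  using steinberg_add_char[OF one_closed _ steinberg_zero, of H U] by simp

lemma steinberg_abelian_monoid: "abelian_monoid (steinberg_algebra R H)"
proof (rule abelian_monoidI)
  fix f g assume "f \<in> carrier (steinberg_algebra R H)" "g \<in> carrier (steinberg_algebra R H)"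
  then show "f \<oplus>\<^bsub>steinberg_algebra R H\<^esub> g = g \<oplus>\<^bsub>steinberg_algebra R H\<^esub> f"
    by (simp add: fun_eq_iff a_comm steinberg_closed[of f H] steinberg_closed[of g H])
next
  fix f g h assume "f \<in> carrier (steinberg_algebra R H)" "g \<in> carrier (steinberg_algebra R H)"
    "h \<in> carrier (steinberg_algebra R H)"
  then show "f \<oplus>\<^bsub>steinberg_algebra R H\<^esub> g \<oplus>\<^bsub>steinberg_algebra R H\<^esub> h
      = f \<oplus>\<^bsub>steinberg_algebra R H\<^esub> (g \<oplus>\<^bsub>steinberg_algebra R H\<^esub> h)"
    by (simp add: fun_eq_iff a_assoc steinberg_closed[of f H] steinberg_closed[of g H]
        steinberg_closed[of h H])
next
  fix f assume "f \<in> carrier (steinberg_algebra R H)"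
  then show "\<zero>\<^bsub>steinberg_algebra R H\<^esub> \<oplus>\<^bsub>steinberg_algebra R H\<^esub> f = f"
    by (simp add: fun_eq_iff steinberg_closed[of f H])
qed (simp_all add: steinberg_add steinberg_zero)

text \<open>This is the bridge from the sums in the algebra that occur in
  \<open>smash_product\<close> and \<open>homogeneous_component\<close> to sums of values in
  \<open>R\<close>.\<close>

lemma steinberg_finsum_apply:
  assumes "finite I" "\<And>i. i \<in> I \<Longrightarrow> F i \<in> carrier (steinberg_algebra R H)"
  shows "(\<Oplus>\<^bsub>steinberg_algebra R H\<^esub>i\<in>I. F i) x = (\<Oplus>i\<in>I. F i x)"
proof -
  interpret A: abelian_monoid "steinberg_algebra R H" by (rule steinberg_abelian_monoid)
  have z: "\<And>x. (\<Oplus>\<^bsub>steinberg_algebra R H\<^esub>i\<in>{}. F i) x = \<zero>"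
    using A.finsum_empty[of F] by simp
  show ?thesis
    using assms
  proof (induction I)
    case (insert i I)
    then have "(\<Oplus>\<^bsub>steinberg_algebra R H\<^esub>i\<in>insert i I. F i)
        = (\<lambda>x. F i x \<oplus> (\<Oplus>\<^bsub>steinberg_algebra R H\<^esub>i\<in>I. F i) x)"
      using A.finsum_insert[of I i F] by (auto simp: Pi_def)
    moreover have "(\<Oplus>i\<in>insert i I. F i x) = F i x \<oplus> (\<Oplus>i\<in>I. F i x)"
      using insert(1,2) steinberg_closed[OF insert(4)] by (intro finsum_insert) (auto simp: Pi_def)
    ultimately show ?case using insert by simp
  qed (simp add: z)
qed

lemma steinberg_finsum_closed:
  assumes "\<And>i. i \<in> I \<Longrightarrow> F i \<in> carrier (steinberg_algebra R H)"
  shows "(\<Oplus>\<^bsub>steinberg_algebra R H\<^esub>i\<in>I. F i) \<in> carrier (steinberg_algebra R H)"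
  by (rule abelian_monoid.finsum_closed[OF steinberg_abelian_monoid]) (simp add: assms)

text \<open>Allowing \<open>K\<close> to index more factorisations than those with nonzero terms is what makes
  convolution additive in both arguments over a common index set.\<close>

lemma convolution_finsum:
  assumes "finite K" "inj_on b K"
    and sub: "\<And>k. k \<in> K \<Longrightarrow> gcomposable H (a k) (b k) \<and> gmult H (a k) (b k) = z"
    and sup: "\<And>x y. \<lbrakk>gcomposable H x y; gmult H x y = z; f x \<noteq> \<zero>; g y \<noteq> \<zero>\<rbrakk>
      \<Longrightarrow> \<exists>k\<in>K. x = a k \<and> y = b k"
    and f: "\<And>x. f x \<in> carrier R" and g: "\<And>x. g x \<in> carrier R"
  shows "convolution R H f g z = (\<Oplus>k\<in>K. f (a k) \<otimes> g (b k))"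
proof -
  \<comment> \<open>These indices match the pairs summed over in \<open>convolution\<close>; every
    other index of \<open>K\<close> contributes a term with a zero factor.\<close>
  define K' where "K' = {k\<in>K. f (a k) \<noteq> \<zero> \<and> g (b k) \<noteq> \<zero>}"
  have "{(x, y). gcomposable H x y \<and> gmult H x y = z \<and> f x \<noteq> \<zero> \<and> g y \<noteq> \<zero>}
      = (\<lambda>k. (a k, b k)) ` K'"
  proof (intro equalityI subsetI)
    fix p assume "p \<in> {(x, y). gcomposable H x y \<and> gmult H x y = z \<and> f x \<noteq> \<zero> \<and> g y \<noteq> \<zero>}"
    then obtain x y where p: "p = (x, y)" "f x \<noteq> \<zero>" "g y \<noteq> \<zero>"
      and "gcomposable H x y" "gmult H x y = z"
      by blast
    then obtain k where "k \<in> K" "x = a k" "y = b k"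
      using sup by blast
    with p show "p \<in> (\<lambda>k. (a k, b k)) ` K'"
      by (simp add: K'_def)
  qed (use sub in \<open>auto simp: K'_def\<close>)
  moreover have "inj_on (\<lambda>k. (a k, b k)) K'"
    using assms(2) by (auto simp: inj_on_def K'_def)
  ultimately have "convolution R H f g z = (\<Oplus>k\<in>K'. f (a k) \<otimes> g (b k))"
    unfolding convolution_def using f g by (simp add: finsum_reindex)
  also have "\<dots> = (\<Oplus>k\<in>K. f (a k) \<otimes> g (b k))"
    by (rule add.finprod_mono_neutral_cong_left) (use assms(1) f g in \<open>auto simp: K'_def\<close>)
  finally show ?thesis .
qed

end

subsection \<open>Bisections\<close>

text \<open>An injective continuous open map is a homeomorphism onto its image. Once the domain and
  range maps are known to be continuous and open, only injectivity depends on \<open>U\<close>. This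
  form serves both \<open>G\<close> and the skew product.\<close>

lemma open_bisectionI:
  assumes "openin (gtop H) U"
    and cont: "\<And>f. f \<in> {gdom H, gran H} \<Longrightarrow>
      continuous_map (gtop H) (subtopology (gtop H) (unit_space H)) f"
    and op: "\<And>f. f \<in> {gdom H, gran H} \<Longrightarrow>
      open_map (gtop H) (subtopology (gtop H) (unit_space H)) f"
    and inj: "inj_on (gdom H) U" "inj_on (gran H) U"
  shows "open_bisection H U"
  unfolding open_bisection_def
proof (intro conjI ballI)
  fix f assume f: "f \<in> {gdom H, gran H}"
  let ?S = "subtopology (gtop H) (unit_space H)"
  have U: "U \<subseteq> topspace (gtop H)" using assms(1) openin_subset by blast
  show *: "openin ?S (f ` U)"
    using op[OF f] assms(1) by (simp add: open_map_def)
  then have fU: "f ` U \<subseteq> unit_space H" using openin_subset by fastforce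
  have "homeomorphic_map (subtopology (gtop H) U) (subtopology ?S (f ` U)) f"
  proof (rule bijective_open_imp_homeomorphic_map)
    show "continuous_map (subtopology (gtop H) U) (subtopology ?S (f ` U)) f"
      using cont[OF f] by (auto simp: continuous_map_in_subtopology continuous_map_from_subtopology)
    show "open_map (subtopology (gtop H) U) (subtopology ?S (f ` U)) f"
      unfolding open_map_def
    proof (intro allI impI)
      fix V assume "openin (subtopology (gtop H) U) V"
      then have "openin (gtop H) V" "V \<subseteq> U"
        using assms(1) by (simp_all add: openin_open_subtopology)
      then show "openin (subtopology ?S (f ` U)) (f ` V)"
        using op[OF f] openin_open_subtopology[OF *, of "f ` V"]
        by (simp add: open_map_def image_mono)
    qed
    show "f ` topspace (subtopology (gtop H) U) = topspace (subtopology ?S (f ` U))"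
      using U openin_subset[OF *] by auto
    show "inj_on f (topspace (subtopology (gtop H) U))"
      using f inj U by (auto simp: inj_on_def)
  qed
  then show "homeomorphic_map (subtopology (gtop H) U) (subtopology (gtop H) (f ` U)) f"
    using fU by (simp add: subtopology_subtopology Int_absorb1)
qed (rule assms(1))

section \<open>Groupoid identities and continuity of the structure maps\<close>

context topological_groupoid
begin

lemma gdom_ginv: "x \<in> topspace (gtop G) \<Longrightarrow> gdom G (ginv G x) = gran G x"
  by (simp add: gdom_def gran_def inv_inv)

lemma gran_ginv: "x \<in> topspace (gtop G) \<Longrightarrow> gran G (ginv G x) = gdom G x"
  by (simp add: gdom_def gran_def inv_inv)

lemma composableD:
  assumes "gcomposable G x y"
  shows "x \<in> topspace (gtop G)" "y \<in> topspace (gtop G)" "gdom G x = gran G y"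
  using assms composable_closed composable_iff by blast+

lemma composable_ginv:
  "x \<in> topspace (gtop G) \<Longrightarrow> gcomposable G x (ginv G x)"
  using inv_composable[OF inv_closed] inv_inv by simp

lemma composable_mult_ginv:
  assumes "gcomposable G x y"
  shows "gcomposable G (gmult G x y) (ginv G y)" "gcomposable G (ginv G x) (gmult G x y)"
  using assoc[OF assms composable_ginv] assoc[OF inv_composable assms] composableD[OF assms]
  by blast+

text \<open>The product can be multiplied on the right by \<open>ginv G y\<close>, whose range is
  the domain of \<open>y\<close>.\<close>

lemma gdom_mult: "gcomposable G x y \<Longrightarrow> gdom G (gmult G x y) = gdom G y"
  using composableD(3)[OF composable_mult_ginv(1)] by (simp add: gran_ginv composableD(2))

lemma gran_mult: "gcomposable G x y \<Longrightarrow> gran G (gmult G x y) = gran G x"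
  using composableD(3)[OF composable_mult_ginv(2)] by (simp add: gdom_ginv composableD(1))

text \<open>A left factor with the correct range always extends to a factorisation of
  \<open>z\<close>; this recovers elements of a product of bisections from their left
  factors.\<close>

lemma mult_ginv_mult_cancel:
  assumes "x \<in> topspace (gtop G)" "z \<in> topspace (gtop G)" "gran G x = gran G z"
  shows "gcomposable G x (gmult G (ginv G x) z)" "gmult G x (gmult G (ginv G x) z) = z"
proof -
  have c: "gcomposable G (ginv G x) z"
    using assms composable_iff gdom_ginv inv_closed by simp
  show "gcomposable G x (gmult G (ginv G x) z)"
    using assoc[OF composable_ginv[OF assms(1)] c] by blast
  show "gmult G x (gmult G (ginv G x) z) = z"
    using inv_mult_cancel[OF c] inv_inv assms(1) by simp
qed

lemma continuous_map_mult:
  assumes "continuous_map X (gtop G) f" "continuous_map X (gtop G) g"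
    and "\<And>x. x \<in> topspace X \<Longrightarrow> gcomposable G (f x) (g x)"
  shows "continuous_map X (gtop G) (\<lambda>x. gmult G (f x) (g x))"
proof -
  have "continuous_map X (subtopology (prod_topology (gtop G) (gtop G)) {(x, y). gcomposable G x y})
      (\<lambda>x. (f x, g x))"
    using assms by (auto simp: continuous_map_in_subtopology continuous_map_pairedI)
  from continuous_map_compose[OF this continuous_mult] show ?thesis
    by (simp add: o_def)
qed

lemma continuous_map_gdom: "continuous_map (gtop G) (subtopology (gtop G) (unit_space G)) (gdom G)"
proof -
  have "continuous_map (gtop G) (gtop G) (\<lambda>x. gmult G (ginv G x) x)"
    by (rule continuous_map_mult) (simp_all add: continuous_inv inv_composable flip: id_def)
  moreover have "gdom G = (\<lambda>x. gmult G (ginv G x) x)"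
    by (simp add: fun_eq_iff gdom_def)
  ultimately show ?thesis
    by (simp add: continuous_map_in_subtopology unit_space_def)
qed

lemma continuous_map_gran: "continuous_map (gtop G) (subtopology (gtop G) (unit_space G)) (gran G)"
proof (rule continuous_map_eq)
  show "continuous_map (gtop G) (subtopology (gtop G) (unit_space G)) (gdom G \<circ> ginv G)"
    using continuous_inv continuous_map_gdom by (rule continuous_map_compose)
qed (simp add: gdom_ginv)

lemma homeomorphic_map_ginv: "homeomorphic_map (gtop G) (gtop G) (ginv G)"
  unfolding homeomorphic_map_maps homeomorphic_maps_def
  using continuous_inv inv_inv by blast

end

section \<open>Openness of the domain and range maps, and a criterion for bisections\<close>

context etale_groupoid
begin

lemma open_map_gdom: "open_map (gtop G) (subtopology (gtop G) (unit_space G)) (gdom G)"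
  unfolding open_map_def
proof (intro allI impI)
  let ?S = "subtopology (gtop G) (unit_space G)"
  fix V assume V: "openin (gtop G) V"
  show "openin ?S (gdom G ` V)"
  proof (subst openin_subopen, intro ballI)
    fix y assume "y \<in> gdom G ` V"
    then obtain x where x: "x \<in> V" "y = gdom G x" by blast
    then have "x \<in> topspace (gtop G)" using V openin_subset by blast
    then obtain U where U: "openin (gtop G) U" "x \<in> U" "openin ?S (gdom G ` U)"
      and hom: "homeomorphic_map (subtopology (gtop G) U) (subtopology ?S (gdom G ` U)) (gdom G)"
      using etale unfolding local_homeomorphic_map_def by blast
    have "openin (subtopology (gtop G) U) (U \<inter> V)"
      using U V by (simp add: openin_open_subtopology openin_Int)
    then have "openin (subtopology ?S (gdom G ` U)) (gdom G ` (U \<inter> V))"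
      using homeomorphic_imp_open_map[OF hom] by (simp add: open_map_def)
    then have "openin ?S (gdom G ` (U \<inter> V))"
      using U(3) openin_open_subtopology by blast
    then show "\<exists>T. openin ?S T \<and> y \<in> T \<and> T \<subseteq> gdom G ` V"
      using x U(2) by blast
  qed
qed

text \<open>The range map is the domain map after inversion, which is a homeomorphism.\<close>

lemma open_map_gran: "open_map (gtop G) (subtopology (gtop G) (unit_space G)) (gran G)"
  unfolding open_map_def
proof (intro allI impI)
  fix V assume V: "openin (gtop G) V"
  then have "gran G ` V = gdom G ` ginv G ` V"
    using gdom_ginv openin_subset[OF V] by (auto simp: image_image intro!: image_cong)
  moreover have "openin (gtop G) (ginv G ` V)"
    using homeomorphic_imp_open_map[OF homeomorphic_map_ginv] V by (simp add: open_map_def)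
  ultimately show "openin (subtopology (gtop G) (unit_space G)) (gran G ` V)"
    using open_map_gdom by (simp add: open_map_def)
qed

lemma compact_open_bisectionI:
  assumes "openin (gtop G) U" "compactin (gtop G) U" "inj_on (gdom G) U" "inj_on (gran G) U"
  shows "compact_open_bisection G U"
  unfolding compact_open_bisection_def
proof
  show "open_bisection G U"
    using assms(1) _ _ assms(3,4)
    by (rule open_bisectionI)
      (use continuous_map_gdom continuous_map_gran open_map_gdom open_map_gran in blast)+
qed (rule assms(2))

text \<open>Openness of \<open>V\<close> keeps the intersection open and closedness keeps it
  compact. The intended \<open>V\<close> are the sets on which the cocycle is constant.\<close>

lemma compact_open_bisection_Int_clopen:
  assumes "compact_open_bisection G U" "openin (gtop G) V" "closedin (gtop G) V"
  shows "compact_open_bisection G (U \<inter> V)"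
proof (rule compact_open_bisectionI)
  note U = compact_open_bisectionD[OF assms(1)]
  show "openin (gtop G) (U \<inter> V)" using U(1) assms(2) by (rule openin_Int)
  show "compactin (gtop G) (U \<inter> V)" using U(2) assms(3) by (rule compact_Int_closedin)
  show "inj_on (gdom G) (U \<inter> V)" using U(4) by (rule inj_on_subset) blast
  show "inj_on (gran G) (U \<inter> V)" using U(5) by (rule inj_on_subset) blast
qed

section \<open>Products of compact open bisections\<close>

definition bisection_mult :: "'a set \<Rightarrow> 'a set \<Rightarrow> 'a set"
  where "bisection_mult U V = {gmult G x y | x y. x \<in> U \<and> y \<in> V \<and> gcomposable G x y}"

text \<open>An element \<open>z\<close> lies in \<open>UV\<close> iff its left factor, the unique \<open>x \<in> U\<close> with the range of \<open>z\<close>,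
  satisfies \<open>x\<^sup>-\<^sup>1 z \<in> V\<close>; as \<open>x\<close> depends continuously on \<open>z\<close>, this is an open condition.\<close>

lemma openin_bisection_mult:
  assumes "open_bisection G U" "openin (gtop G) V"
  shows "openin (gtop G) (bisection_mult U V)"
proof -
  let ?S = "subtopology (gtop G) (unit_space G)"
  from assms(1) have U: "openin (gtop G) U" and rU: "openin ?S (gran G ` U)"
    and hom: "homeomorphic_map (subtopology (gtop G) U) (subtopology (gtop G) (gran G ` U)) (gran G)"
    by (simp_all add: open_bisection_def)
  have UG: "U \<subseteq> topspace (gtop G)" using U openin_subset by blast
  \<comment> \<open>The map \<open>s\<close> inverts the range map on \<open>U\<close>. Hence
    \<open>s (gran G z)\<close> is the only possible left factor of \<open>z\<close> in
    \<open>U\<close>, and \<open>\<psi> z\<close> below is the corresponding right factor.\<close>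
  obtain s where s: "continuous_map (subtopology (gtop G) (gran G ` U)) (subtopology (gtop G) U) s"
    and sr: "\<And>x. x \<in> U \<Longrightarrow> s (gran G x) = x"
    using hom UG unfolding homeomorphic_map_maps homeomorphic_maps_def
    by (auto simp: Int_absorb1)
  define D where "D = {z \<in> topspace (gtop G). gran G z \<in> gran G ` U}"
  have D: "openin (gtop G) D"
    unfolding D_def by (rule openin_continuous_map_preimage[OF continuous_map_gran rU])
  have sD: "s (gran G z) \<in> U" "gran G (s (gran G z)) = gran G z" if "z \<in> D" for z
    using that sr by (auto simp: D_def)
  define \<psi> where "\<psi> = (\<lambda>z. gmult G (ginv G (s (gran G z))) z)"
  have top: "topspace (subtopology (gtop G) D) = D"
    using D openin_subset by fastforce
  have "continuous_map (subtopology (gtop G) D) (subtopology (gtop G) (gran G ` U)) (gran G)"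
    using continuous_map_gran top
    by (auto simp: continuous_map_in_subtopology continuous_map_from_subtopology D_def)
  from continuous_map_compose[OF this s]
  have "continuous_map (subtopology (gtop G) D) (gtop G) (\<lambda>z. s (gran G z))"
    by (simp add: continuous_map_in_subtopology o_def)
  from continuous_map_compose[OF this continuous_inv]
  have "continuous_map (subtopology (gtop G) D) (gtop G) (\<lambda>z. ginv G (s (gran G z)))"
    by (simp add: o_def)
  then have "continuous_map (subtopology (gtop G) D) (gtop G) \<psi>"
    unfolding \<psi>_def
  proof (rule continuous_map_mult)
    fix z assume "z \<in> topspace (subtopology (gtop G) D)"
    then have z: "z \<in> D" using top by simp
    then have zG: "z \<in> topspace (gtop G)" "s (gran G z) \<in> topspace (gtop G)"
      using sD(1) UG by (auto simp: D_def)
    then show "gcomposable G (ginv G (s (gran G z))) z"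
      using sD(2)[OF z] composable_iff inv_closed gdom_ginv by simp
  qed (simp add: continuous_map_from_subtopology flip: id_def)
  then have "openin (subtopology (gtop G) D) {z \<in> D. \<psi> z \<in> V}"
    using openin_continuous_map_preimage[OF _ assms(2)] top by metis
  then have "openin (gtop G) {z \<in> D. \<psi> z \<in> V}"
    using D openin_open_subtopology by blast
  moreover have "{z \<in> D. \<psi> z \<in> V} = bisection_mult U V"
  proof (intro equalityI subsetI)
    fix z assume "z \<in> {z \<in> D. \<psi> z \<in> V}"
    then have z: "z \<in> D" "\<psi> z \<in> V" by auto
    then have "gcomposable G (s (gran G z)) (\<psi> z)" "gmult G (s (gran G z)) (\<psi> z) = z"
      using mult_ginv_mult_cancel[of "s (gran G z)" z] sD[OF z(1)] UG
      by (auto simp: \<psi>_def D_def)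
    then show "z \<in> bisection_mult U V"
      using z(2) sD(1)[OF z(1)] unfolding bisection_mult_def by (metis (mono_tags, lifting) mem_Collect_eq)
  next
    fix z assume "z \<in> bisection_mult U V"
    then obtain x y where xy: "z = gmult G x y" "x \<in> U" "y \<in> V" "gcomposable G x y"
      unfolding bisection_mult_def by blast
    then have "gran G z = gran G x" "\<psi> z = y" "z \<in> topspace (gtop G)"
      using gran_mult sr inv_mult_cancel mult_closed by (simp_all add: \<psi>_def)
    then show "z \<in> {z \<in> D. \<psi> z \<in> V}"
      using xy by (simp add: D_def)
  qed
  ultimately show ?thesis by simp
qed

text \<open>Composable pairs form the equaliser of two continuous maps into a Hausdorff space, hence
  a closed set. Those in \<open>U \<times> V\<close> therefore form a compact set, and
  multiplication carries it onto the product.\<close>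

lemma compactin_bisection_mult:
  assumes "Hausdorff_space (gtop G)" "compactin (gtop G) U" "compactin (gtop G) V"
  shows "compactin (gtop G) (bisection_mult U V)"
proof -
  let ?P = "prod_topology (gtop G) (gtop G)"
  let ?C = "{p \<in> topspace ?P. (gdom G \<circ> fst) p = (gran G \<circ> snd) p}"
  have "closedin ?P ?C"
    using continuous_map_gdom continuous_map_gran assms(1)
    by (intro closedin_continuous_maps_eq[of "gtop G"] continuous_map_compose[of _ "gtop G"]
          continuous_map_fst continuous_map_snd)
      (auto simp: continuous_map_in_subtopology)
  moreover have "compactin ?P (U \<times> V)"
    using assms by (simp add: compactin_Times)
  ultimately have "compactin ?P (U \<times> V \<inter> ?C)"
    by (rule compact_Int_closedin[rotated])
  moreover have "U \<times> V \<inter> ?C \<subseteq> {(x, y). gcomposable G x y}"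
    using composable_iff by auto
  ultimately have "compactin (subtopology ?P {(x, y). gcomposable G x y}) (U \<times> V \<inter> ?C)"
    by (simp add: compactin_subtopology)
  from image_compactin[OF this continuous_mult]
  have "compactin (gtop G) ((\<lambda>(x, y). gmult G x y) ` (U \<times> V \<inter> ?C))" .
  moreover have "(\<lambda>(x, y). gmult G x y) ` (U \<times> V \<inter> ?C) = bisection_mult U V"
  proof (intro equalityI subsetI)
    fix z assume "z \<in> bisection_mult U V"
    then obtain x y where "z = gmult G x y" "x \<in> U" "y \<in> V" and xy: "gcomposable G x y"
      unfolding bisection_mult_def by blast
    then show "z \<in> (\<lambda>(x, y). gmult G x y) ` (U \<times> V \<inter> ?C)"
      using composableD[OF xy] by (intro image_eqI[where x = "(x, y)"]) simp_all
  next
    fix z assume "z \<in> (\<lambda>(x, y). gmult G x y) ` (U \<times> V \<inter> ?C)"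
    then obtain x y where "z = gmult G x y" "x \<in> U" "y \<in> V" "gcomposable G x y"
      using composable_iff by auto
    then show "z \<in> bisection_mult U V"
      unfolding bisection_mult_def by blast
  qed
  ultimately show ?thesis by simp
qed

lemma compact_open_bisection_mult:
  assumes "Hausdorff_space (gtop G)" "compact_open_bisection G U" "compact_open_bisection G V"
  shows "compact_open_bisection G (bisection_mult U V)"
proof (rule compact_open_bisectionI)
  note U = compact_open_bisectionD[OF assms(2)] and V = compact_open_bisectionD[OF assms(3)]
  show "openin (gtop G) (bisection_mult U V)"
    using assms(2) V(1) by (simp add: compact_open_bisection_def openin_bisection_mult)
  show "compactin (gtop G) (bisection_mult U V)"
    using assms(1) U(2) V(2) by (rule compactin_bisection_mult)
  \<comment> \<open>Equal domains of the products force \<open>y = y'\<close>, and equal ranges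
    force \<open>x = x'\<close>. Either way composability transports the equality to the middle
    unit, where injectivity on the other bisection gives the remaining factor.\<close>
  have *: "x = x' \<and> y = y'"
    if "gcomposable G x y" "gcomposable G x' y'" "x \<in> U" "x' \<in> U" "y \<in> V" "y' \<in> V"
      "gdom G (gmult G x y) = gdom G (gmult G x' y') \<or> gran G (gmult G x y) = gran G (gmult G x' y')"
    for x y x' y'
  proof -
    have "gdom G y = gdom G y' \<or> gran G x = gran G x'"
      using that gdom_mult gran_mult by simp
    then have "x = x' \<or> y = y'"
      using that U(5) V(4) by (auto dest: inj_onD)
    then have "gdom G x = gdom G x'" "gran G y = gran G y'"
      using composableD(3)[OF that(1)] composableD(3)[OF that(2)] by auto
    then show ?thesis
      using that U(4) V(5) by (auto dest: inj_onD)
  qed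
  show "inj_on (gdom G) (bisection_mult U V)" "inj_on (gran G) (bisection_mult U V)"
    unfolding bisection_mult_def inj_on_def using * by blast+
qed

end

subsection \<open>Convolution\<close>

locale hausdorff_steinberg = etale_groupoid G + cring R
  for R :: "('r, 'k) ring_scheme" (structure) and G :: "('g, 'm) top_groupoid_scheme" +
  assumes Hausdorff: "Hausdorff_space (gtop G)"
begin

abbreviation A where "A \<equiv> steinberg_algebra R G"

text \<open>The left function does not occur, so convolutions of different functions with the same
  \<open>g\<close> can be compared over one index set.\<close>

definition right_factors :: "('g \<Rightarrow> 'r) \<Rightarrow> 'g \<Rightarrow> 'g set"
  where "right_factors g z = {y. g y \<noteq> \<zero> \<and> (\<exists>x. gcomposable G x y \<and> gmult G x y = z)}"

text \<open>All right factors of \<open>z\<close> have the domain of \<open>z\<close>, so a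
  bisection contains at most one of them.\<close>

lemma finite_right_factors: "g \<in> carrier A \<Longrightarrow> finite (right_factors g z)"
proof (induction rule: steinberg_induct)
  case (add_char a U v)
  have "inj_on (gdom G) (right_factors (char_fun R U) z)"
    by (rule inj_on_subset[OF compact_open_bisectionD(4)[OF add_char(2)]])
      (auto simp: right_factors_def char_fun_def)
  moreover have "gdom G ` right_factors (char_fun R U) z \<subseteq> {gdom G z}"
    using gdom_mult by (auto simp: right_factors_def)
  ultimately have "finite (right_factors (char_fun R U) z)"
    using finite_imageD finite_subset by blast
  moreover have "right_factors (\<lambda>x. a \<otimes> char_fun R U x \<oplus> v x) z
      \<subseteq> right_factors (char_fun R U) z \<union> right_factors v z"
    using add_char(1) by (auto simp: right_factors_def)
  ultimately show ?case
    using add_char(4) finite_subset by blast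
qed (simp add: right_factors_def)

text \<open>The right factor \<open>y\<close> determines the left one, as the product of
  \<open>z\<close> with the inverse of \<open>y\<close>.\<close>

lemma convolution_right_factors:
  assumes "finite K" "right_factors g z \<subseteq> K"
    and K: "\<And>y. y \<in> K \<Longrightarrow> \<exists>x. gcomposable G x y \<and> gmult G x y = z"
    and "\<And>x. f x \<in> carrier R" "\<And>x. g x \<in> carrier R"
  shows "convolution R G f g z = (\<Oplus>y\<in>K. f (gmult G z (ginv G y)) \<otimes> g y)"
proof (rule convolution_finsum)
  fix y assume "y \<in> K"
  then obtain x where "gcomposable G x y" "gmult G x y = z" using K by blast
  then show "gcomposable G (gmult G z (ginv G y)) y \<and> gmult G (gmult G z (ginv G y)) y = z"
    using mult_inv_cancel by force
next
  fix x y assume xy: "gcomposable G x y" "gmult G x y = z" "g y \<noteq> \<zero>"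
  then have "y \<in> K" using assms(2) by (auto simp: right_factors_def)
  moreover have "x = gmult G z (ginv G y)" using mult_inv_cancel xy(1,2) by force
  ultimately show "\<exists>k\<in>K. x = gmult G z (ginv G k) \<and> y = k" by blast
qed (use assms in auto)

lemma convolution_right_factors':
  assumes "f \<in> carrier A" "g \<in> carrier A"
  shows "convolution R G f g z = (\<Oplus>y\<in>right_factors g z. f (gmult G z (ginv G y)) \<otimes> g y)"
  using finite_right_factors[OF assms(2)] steinberg_closed[OF assms(1)] steinberg_closed[OF assms(2)]
  by (intro convolution_right_factors) (auto simp: right_factors_def)

lemma convolution_linear_left:
  assumes "a \<in> carrier R" "s \<in> carrier A" "v \<in> carrier A" "g \<in> carrier A"
  shows "convolution R G (\<lambda>x. a \<otimes> s x \<oplus> v x) g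
    = (\<lambda>z. a \<otimes> convolution R G s g z \<oplus> convolution R G v g z)"
proof
  fix z
  note closed = assms(1) steinberg_closed[OF assms(2)] steinberg_closed[OF assms(3)]
    steinberg_closed[OF assms(4)]
  let ?K = "right_factors g z" and ?x = "\<lambda>y. gmult G z (ginv G y)"
  have "convolution R G (\<lambda>x. a \<otimes> s x \<oplus> v x) g z = (\<Oplus>y\<in>?K. (a \<otimes> s (?x y) \<oplus> v (?x y)) \<otimes> g y)"
    using closed finite_right_factors[OF assms(4)]
    by (intro convolution_right_factors) (auto simp: right_factors_def)
  also have "\<dots> = (\<Oplus>y\<in>?K. a \<otimes> (s (?x y) \<otimes> g y) \<oplus> v (?x y) \<otimes> g y)"
    using closed by (intro finsum_cong') (auto simp: l_distr m_assoc)
  also have "\<dots> = (\<Oplus>y\<in>?K. a \<otimes> (s (?x y) \<otimes> g y)) \<oplus> (\<Oplus>y\<in>?K. v (?x y) \<otimes> g y)"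
    using closed by (intro finsum_addf) auto
  also have "(\<Oplus>y\<in>?K. a \<otimes> (s (?x y) \<otimes> g y)) = a \<otimes> (\<Oplus>y\<in>?K. s (?x y) \<otimes> g y)"
    using closed finite_right_factors[OF assms(4)] by (intro finsum_rdistr[symmetric]) auto
  finally show "convolution R G (\<lambda>x. a \<otimes> s x \<oplus> v x) g z
      = a \<otimes> convolution R G s g z \<oplus> convolution R G v g z"
    by (simp add: convolution_right_factors' assms)
qed

lemma convolution_linear_right:
  assumes "a \<in> carrier R" "f \<in> carrier A" "t \<in> carrier A" "v \<in> carrier A"
  shows "convolution R G f (\<lambda>x. a \<otimes> t x \<oplus> v x)
    = (\<lambda>z. a \<otimes> convolution R G f t z \<oplus> convolution R G f v z)"
proof
  fix z
  note closed = assms(1) steinberg_closed[OF assms(2)] steinberg_closed[OF assms(3)]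
    steinberg_closed[OF assms(4)]
  \<comment> \<open>The right factors for the combined function lie in this union, so all three
    convolutions can be written over it.\<close>
  let ?K = "right_factors t z \<union> right_factors v z" and ?x = "\<lambda>y. gmult G z (ginv G y)"
  have K: "finite ?K"
    using assms finite_right_factors by simp
  have "convolution R G f (\<lambda>x. a \<otimes> t x \<oplus> v x) z = (\<Oplus>y\<in>?K. f (?x y) \<otimes> (a \<otimes> t y \<oplus> v y))"
    using closed K by (intro convolution_right_factors) (auto simp: right_factors_def)
  also have "\<dots> = (\<Oplus>y\<in>?K. a \<otimes> (f (?x y) \<otimes> t y) \<oplus> f (?x y) \<otimes> v y)"
    using closed by (intro finsum_cong') (auto simp: r_distr m_lcomm)
  also have "\<dots> = (\<Oplus>y\<in>?K. a \<otimes> (f (?x y) \<otimes> t y)) \<oplus> (\<Oplus>y\<in>?K. f (?x y) \<otimes> v y)"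
    using closed by (intro finsum_addf) auto
  also have "(\<Oplus>y\<in>?K. a \<otimes> (f (?x y) \<otimes> t y)) = a \<otimes> (\<Oplus>y\<in>?K. f (?x y) \<otimes> t y)"
    using closed K by (intro finsum_rdistr[symmetric]) auto
  also have "(\<Oplus>y\<in>?K. f (?x y) \<otimes> t y) = convolution R G f t z"
    using closed K by (intro convolution_right_factors[symmetric]) (auto simp: right_factors_def)
  also have "(\<Oplus>y\<in>?K. f (?x y) \<otimes> v y) = convolution R G f v z"
    using closed K by (intro convolution_right_factors[symmetric]) (auto simp: right_factors_def)
  finally show "convolution R G f (\<lambda>x. a \<otimes> t x \<oplus> v x) z
      = a \<otimes> convolution R G f t z \<oplus> convolution R G f v z" .
qed

text \<open>The range of \<open>z\<close> determines the factor in \<open>U\<close> and its domain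
  the factor in \<open>V\<close>, so at most one term is nonzero.\<close>

lemma convolution_char:
  assumes "compact_open_bisection G U" "compact_open_bisection G V"
  shows "convolution R G (char_fun R U) (char_fun R V) = char_fun R (bisection_mult U V)"
proof
  fix z
  show "convolution R G (char_fun R U) (char_fun R V) z = char_fun R (bisection_mult U V) z"
  proof (cases "z \<in> bisection_mult U V")
    case True
    then obtain x y where xy: "x \<in> U" "y \<in> V" "gcomposable G x y" "gmult G x y = z"
      unfolding bisection_mult_def by blast
    have unique: "x' = x \<and> y' = y"
      if "gcomposable G x' y'" "gmult G x' y' = z" "x' \<in> U" "y' \<in> V" for x' y'
    proof
      have "gran G x' = gran G x" "gdom G y' = gdom G y"
        using gran_mult[OF that(1)] gran_mult[OF xy(3)] gdom_mult[OF that(1)] gdom_mult[OF xy(3)]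
          that(2) xy(4) by simp_all
      then show "x' = x" "y' = y"
        using compact_open_bisectionD(5)[OF assms(1)] compact_open_bisectionD(4)[OF assms(2)]
          that(3,4) xy(1,2) by (auto dest: inj_onD)
    qed
    \<comment> \<open>The one-point index set \<open>{()}\<close> stands for the unique
      factorisation.\<close>
    have "convolution R G (char_fun R U) (char_fun R V) z
        = (\<Oplus>k\<in>{()}. char_fun R U x \<otimes> char_fun R V y)"
    proof (rule convolution_finsum)
      fix x' y' assume "gcomposable G x' y'" "gmult G x' y' = z"
        "char_fun R U x' \<noteq> \<zero>" "char_fun R V y' \<noteq> \<zero>"
      then show "\<exists>k\<in>{()}. x' = x \<and> y' = y"
        using unique[of x' y'] by (simp add: char_fun_def split: if_splits)
    qed (simp_all add: xy)
    then show ?thesis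
      using xy True by (simp add: char_fun_def)
  next
    case False
    then have none: "\<not> (gcomposable G x y \<and> gmult G x y = z \<and> x \<in> U \<and> y \<in> V)" for x y
      unfolding bisection_mult_def by blast
    have "convolution R G (char_fun R U) (char_fun R V) z = (\<Oplus>k\<in>{}. char_fun R U k \<otimes> char_fun R V k)"
    proof (rule convolution_finsum)
      fix x y assume "gcomposable G x y" "gmult G x y = z"
        "char_fun R U x \<noteq> \<zero>" "char_fun R V y \<noteq> \<zero>"
      then show "\<exists>k\<in>{}. x = k \<and> y = k"
        using none[of x y] by (simp add: char_fun_def split: if_splits)
    qed simp_all
    then show ?thesis
      using False by (simp add: char_fun_def)
  qed
qed

text \<open>Induction on both arguments reduces by bilinearity to two characteristic functions,
  whose convolution is that of the product bisection.\<close>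

lemma convolution_closed:
  assumes "f \<in> carrier A" "g \<in> carrier A"
  shows "convolution R G f g \<in> carrier A"
  using assms(1)
proof (induction rule: steinberg_induct)
  case zero
  have "convolution R G (\<lambda>x. \<zero>) g = (\<lambda>z. \<zero>)"
    by (simp add: convolution_def)
  then show ?case using steinberg_zero by simp
next
  case (add_char a U v)
  have "convolution R G (char_fun R U) g \<in> carrier A"
    using assms(2)
  proof (induction rule: steinberg_induct)
    case zero
    have "convolution R G (char_fun R U) (\<lambda>x. \<zero>) = (\<lambda>z. \<zero>)"
      by (simp add: convolution_def)
    then show ?case using steinberg_zero by simp
  next
    case (add_char b V w)
    have "convolution R G (char_fun R U) (char_fun R V) \<in> carrier A"
      using \<open>compact_open_bisection G U\<close> add_char(2) Hausdorff
      by (simp add: convolution_char steinberg_char compact_open_bisection_mult)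
    then show ?case
      using add_char \<open>compact_open_bisection G U\<close>
      by (simp add: convolution_linear_right steinberg_char steinberg_add steinberg_smult)
  qed
  then show ?case
    using add_char assms(2)
    by (simp add: convolution_linear_left steinberg_char steinberg_add steinberg_smult)
qed

end

subsection \<open>Homogeneous components\<close>

lemma (in cring) steinberg_grading_iff:
  "f \<in> steinberg_grading R H c \<gamma> \<longleftrightarrow>
    f \<in> carrier (steinberg_algebra R H) \<and> (\<forall>x. f x \<noteq> \<zero> \<longrightarrow> c x = \<gamma>)"
  using steinberg_outside[of f H] unfolding steinberg_grading_def by blast

text \<open>The index \<open>i\<close> may lie outside \<open>F\<close> when its term vanishes, so
  \<open>F\<close> can be taken to be a support.\<close>

lemma (in cring) finsum_delta:
  assumes "finite F" "i \<notin> F \<Longrightarrow> a i = \<zero>" "a i \<in> carrier R"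
  shows "(\<Oplus>j\<in>F. if i = j then a j else \<zero>) = a i"
proof -
  have "(\<Oplus>j\<in>F. if i = j then a j else \<zero>) = (\<Oplus>j\<in>insert i F. if i = j then a i else \<zero>)"
    by (rule add.finprod_mono_neutral_cong_left) (use assms in auto)
  also have "\<dots> = a i"
    using finsum_singleton[of i "insert i F" "\<lambda>_. a i"] assms by simp
  finally show ?thesis .
qed

locale graded_steinberg = hausdorff_steinberg R G + grading: groupoid_grading \<Gamma> G c
  for R :: "('r, 'k) ring_scheme" (structure) and \<Gamma> :: "('h, 'n) monoid_scheme"
    and G :: "('g, 'm) top_groupoid_scheme" and c :: "'g \<Rightarrow> 'h"
begin

definition degree_part :: "('g \<Rightarrow> 'r) \<Rightarrow> 'h \<Rightarrow> 'g \<Rightarrow> 'r"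
  where "degree_part f \<gamma> = (\<lambda>x. if c x = \<gamma> then f x else \<zero>)"

lemma c_closed: "x \<in> topspace (gtop G) \<Longrightarrow> c x \<in> carrier \<Gamma>"
  using continuous_map_image_subset_topspace[OF grading.cocycle_continuous] by auto

lemma clopen_degree:
  assumes "\<gamma> \<in> carrier \<Gamma>"
  shows "openin (gtop G) {x \<in> topspace (gtop G). c x = \<gamma>}"
    "closedin (gtop G) {x \<in> topspace (gtop G). c x = \<gamma>}"
  using openin_continuous_map_preimage[OF grading.cocycle_continuous, of "{\<gamma>}"]
    closedin_continuous_map_preimage[OF grading.cocycle_continuous, of "{\<gamma>}"] assms
  by simp_all

text \<open>The image of a compact bisection under the cocycle is compact in a discrete space, hence
  finite.\<close>

lemma finite_degrees: "f \<in> carrier A \<Longrightarrow> finite (c ` {x. f x \<noteq> \<zero>})"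
proof (induction rule: steinberg_induct)
  case (add_char a U v)
  have "finite (c ` U)"
    using image_compactin[OF compact_open_bisectionD(2)[OF add_char(2)] grading.cocycle_continuous]
    by (simp add: compactin_discrete_topology)
  moreover have "c ` {x. a \<otimes> char_fun R U x \<oplus> v x \<noteq> \<zero>} \<subseteq> c ` U \<union> c ` {x. v x \<noteq> \<zero>}"
    using add_char(1) by (auto simp: char_fun_def)
  ultimately show ?case
    using add_char(4) finite_subset by blast
qed simp

lemma degree_part_closed:
  assumes "f \<in> carrier A" "\<gamma> \<in> carrier \<Gamma>"
  shows "degree_part f \<gamma> \<in> carrier A"
  using assms(1)
proof (induction rule: steinberg_induct)
  case (add_char a U v)
  let ?C = "{x \<in> topspace (gtop G). c x = \<gamma>}"
  have "degree_part (\<lambda>x. a \<otimes> char_fun R U x \<oplus> v x) \<gamma>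
      = (\<lambda>x. a \<otimes> char_fun R (U \<inter> ?C) x \<oplus> degree_part v \<gamma> x)"
    using add_char(1) compact_open_bisectionD(3)[OF add_char(2)]
    by (intro ext) (auto simp: degree_part_def char_fun_def)
  moreover have "compact_open_bisection G (U \<inter> ?C)"
    using add_char(2) clopen_degree[OF assms(2)] by (rule compact_open_bisection_Int_clopen)
  ultimately show ?case
    using steinberg_add_char add_char(1,4) by simp
qed (simp add: degree_part_def steinberg_zero)

text \<open>Degree parts give existence. For uniqueness, evaluate any decomposition at
  \<open>x\<close>: only the component of degree \<open>c x\<close> can be nonzero there, so it
  takes the value \<open>s x\<close>.\<close>

lemma homogeneous_component_eq:
  assumes s: "s \<in> carrier A" and \<gamma>: "\<gamma> \<in> carrier \<Gamma>"
  shows "homogeneous_component \<Gamma> A (steinberg_grading R G c) s \<gamma> = degree_part s \<gamma>"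
proof -
  define u where "u = (\<lambda>\<gamma>. if \<gamma> \<in> carrier \<Gamma> then degree_part s \<gamma> else (\<lambda>x. \<zero>))"
  let ?P = "\<lambda>u. (\<forall>\<gamma> \<in> carrier \<Gamma>. u \<gamma> \<in> steinberg_grading R G c \<gamma>)
    \<and> (\<forall>\<gamma>. \<gamma> \<notin> carrier \<Gamma> \<longrightarrow> u \<gamma> = \<zero>\<^bsub>A\<^esub>) \<and> finite {\<gamma>. u \<gamma> \<noteq> \<zero>\<^bsub>A\<^esub>}
    \<and> s = (\<Oplus>\<^bsub>A\<^esub>\<gamma> \<in> {\<gamma>. u \<gamma> \<noteq> \<zero>\<^bsub>A\<^esub>}. u \<gamma>)"
  have sum: "(\<Oplus>\<^bsub>A\<^esub>\<gamma> \<in> {\<gamma>. w \<gamma> \<noteq> \<zero>\<^bsub>A\<^esub>}. w \<gamma>) x = w (c x) x"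
    if w: "\<And>\<gamma>. \<gamma> \<in> carrier \<Gamma> \<Longrightarrow> w \<gamma> \<in> steinberg_grading R G c \<gamma>"
      "\<And>\<gamma>. \<gamma> \<notin> carrier \<Gamma> \<Longrightarrow> w \<gamma> = \<zero>\<^bsub>A\<^esub>" "finite {\<gamma>. w \<gamma> \<noteq> \<zero>\<^bsub>A\<^esub>}" for w x
  proof -
    let ?F = "{\<gamma>. w \<gamma> \<noteq> \<zero>\<^bsub>A\<^esub>}"
    have wA: "w \<gamma> \<in> carrier A" for \<gamma>
      using w(1,2)[of \<gamma>] steinberg_zero by (cases "\<gamma> \<in> carrier \<Gamma>") (auto simp: steinberg_grading_iff)
    have "(\<Oplus>\<^bsub>A\<^esub>\<gamma> \<in> ?F. w \<gamma>) x = (\<Oplus>\<gamma>\<in>?F. w \<gamma> x)"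
      by (rule steinberg_finsum_apply) (use w(3) wA in auto)
    also have "\<dots> = (\<Oplus>\<gamma>\<in>?F. if c x = \<gamma> then w \<gamma> x else \<zero>)"
    proof (rule finsum_cong')
      fix \<gamma> assume "\<gamma> \<in> ?F"
      then have "\<gamma> \<in> carrier \<Gamma>" using w(2) by blast
      then show "w \<gamma> x = (if c x = \<gamma> then w \<gamma> x else \<zero>)"
        using w(1) by (auto simp: steinberg_grading_iff)
    qed (use steinberg_closed[OF wA] in auto)
    also have "\<dots> = w (c x) x"
      using w(3) steinberg_closed[OF wA] by (intro finsum_delta) simp_all
    finally show ?thesis .
  qed
  have u0: "u \<gamma> x = (if \<gamma> \<in> carrier \<Gamma> \<and> c x = \<gamma> then s x else \<zero>)" for \<gamma> x
    by (simp add: u_def degree_part_def)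
  \<comment> \<open>Off the underlying set \<open>c x\<close> may lie outside the group, but there
    \<open>s\<close> vanishes too.\<close>
  have uc: "u (c x) x = s x" for x
    using u0 c_closed[of x] steinberg_outside[OF s, of x] by (cases "x \<in> topspace (gtop G)") auto
  have "?P u"
  proof (intro conjI ballI allI impI)
    show *: "u \<gamma> \<in> steinberg_grading R G c \<gamma>" if "\<gamma> \<in> carrier \<Gamma>" for \<gamma>
      using that degree_part_closed[OF s that]
      by (simp add: u_def steinberg_grading_iff) (simp add: degree_part_def)
    show **: "u \<gamma> = \<zero>\<^bsub>A\<^esub>" if "\<gamma> \<notin> carrier \<Gamma>" for \<gamma>
      using that by (simp add: u_def)
    have "{\<gamma>. u \<gamma> \<noteq> \<zero>\<^bsub>A\<^esub>} \<subseteq> c ` {x. s x \<noteq> \<zero>}"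
      by (auto simp: u0 fun_eq_iff split: if_splits)
    then show fin: "finite {\<gamma>. u \<gamma> \<noteq> \<zero>\<^bsub>A\<^esub>}"
      using finite_degrees[OF s] finite_subset by blast
    show "s = (\<Oplus>\<^bsub>A\<^esub>\<gamma> \<in> {\<gamma>. u \<gamma> \<noteq> \<zero>\<^bsub>A\<^esub>}. u \<gamma>)"
      using sum[OF * ** fin] uc by presburger
  qed
  moreover have "w = u" if "?P w" for w
  proof (intro ext)
    fix \<gamma> x
    from that have s_eq: "s x = w (c x) x" using sum[of w x] by metis
    show "w \<gamma> x = u \<gamma> x"
    proof (cases "\<gamma> \<in> carrier \<Gamma>")
      case True
      then have "w \<gamma> x \<noteq> \<zero> \<Longrightarrow> c x = \<gamma>"
        using that by (simp add: steinberg_grading_iff)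
      then show ?thesis using True s_eq u0 by auto
    next
      case False
      then show ?thesis using that u0 by simp
    qed
  qed
  ultimately have "homogeneous_component \<Gamma> A (steinberg_grading R G c) s = u"
    unfolding homogeneous_component_def by (rule the_equality)
  then show ?thesis using \<gamma> by (simp add: u_def)
qed

end

subsection \<open>Skew products\<close>

lemma skew_product_simps [simp]:
  "gtop (skew_product \<Gamma> G c) = prod_topology (gtop G) (discrete_topology (carrier \<Gamma>))"
  "gcomposable (skew_product \<Gamma> G c) (x, \<alpha>) (y, \<beta>) \<longleftrightarrow>
    gcomposable G x y \<and> \<alpha> \<in> carrier \<Gamma> \<and> \<beta> \<in> carrier \<Gamma> \<and> \<alpha> = c y \<otimes>\<^bsub>\<Gamma>\<^esub> \<beta>"
  "gmult (skew_product \<Gamma> G c) (x, \<alpha>) (y, \<beta>) = (gmult G x y, \<beta>)"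
  "ginv (skew_product \<Gamma> G c) (x, \<alpha>) = (ginv G x, c x \<otimes>\<^bsub>\<Gamma>\<^esub> \<alpha>)"
  by (simp_all add: skew_product_def)

lemma gdom_skew_product: "gdom (skew_product \<Gamma> G c) = (\<lambda>(x, \<alpha>). (gdom G x, \<alpha>))"
  by (auto simp: gdom_def)

text \<open>A product keeps the second coordinate of its right factor, and the inverse of
  \<open>(x, \<alpha>)\<close> carries the coordinate twisted by \<open>c x\<close>. So the range
  map is twisted and the domain map is not.\<close>

lemma gran_skew_product:
  "gran (skew_product \<Gamma> G c) = (\<lambda>(x, \<alpha>). (gran G x, c x \<otimes>\<^bsub>\<Gamma>\<^esub> \<alpha>))"
  by (auto simp: gran_def)

lemma unit_space_skew_product: "unit_space (skew_product \<Gamma> G c) = unit_space G \<times> carrier \<Gamma>"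
  by (force simp: unit_space_def gdom_skew_product)

context graded_steinberg
begin

abbreviation S where "S \<equiv> skew_product \<Gamma> G c"

abbreviation B where "B \<equiv> steinberg_algebra R S"

lemma subtopology_unit_space_skew_product:
  "subtopology (gtop S) (unit_space S)
    = prod_topology (subtopology (gtop G) (unit_space G)) (discrete_topology (carrier \<Gamma>))"
  by (simp add: unit_space_skew_product subtopology_Times)

text \<open>The parameter \<open>q\<close> covers both structure maps: projection to
  \<open>\<alpha>\<close> for the domain, group multiplication for the range. The second coordinate
  factors through a discrete space, where continuity is automatic.\<close>

lemma continuous_map_twisted:
  assumes "continuous_map (gtop G) X h"
    and q: "\<And>\<gamma> \<alpha>. \<lbrakk>\<gamma> \<in> carrier \<Gamma>; \<alpha> \<in> carrier \<Gamma>\<rbrakk> \<Longrightarrow> q \<gamma> \<alpha> \<in> carrier \<Gamma>"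
  shows "continuous_map (gtop S) (prod_topology X (discrete_topology (carrier \<Gamma>)))
    (\<lambda>(x, \<alpha>). (h x, q (c x) \<alpha>))"
proof -
  let ?D = "discrete_topology (carrier \<Gamma>)"
  have "continuous_map (gtop S) X (h \<circ> fst)"
    using assms(1) by (simp add: continuous_map_compose[OF continuous_map_fst])
  moreover have "continuous_map (gtop S) ?D ((\<lambda>(\<gamma>, \<alpha>). q \<gamma> \<alpha>) \<circ> (\<lambda>p. ((c \<circ> fst) p, snd p)))"
  proof (rule continuous_map_compose)
    show "continuous_map (gtop S) (prod_topology ?D ?D) (\<lambda>p. ((c \<circ> fst) p, snd p))"
    proof (rule continuous_map_pairedI)
      show "continuous_map (gtop S) ?D (c \<circ> fst)"
        by (rule continuous_map_compose[OF _ grading.cocycle_continuous])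
          (simp add: continuous_map_fst)
    qed (simp add: continuous_map_snd)
    show "continuous_map (prod_topology ?D ?D) ?D (\<lambda>(\<gamma>, \<alpha>). q \<gamma> \<alpha>)"
      using q by (auto simp flip: prod_topology_discrete_topology)
  qed
  ultimately have "continuous_map (gtop S) (prod_topology X ?D)
      (\<lambda>p. ((h \<circ> fst) p, ((\<lambda>(\<gamma>, \<alpha>). q \<gamma> \<alpha>) \<circ> (\<lambda>p. ((c \<circ> fst) p, snd p))) p))"
    by (rule continuous_map_pairedI)
  then show ?thesis by (simp add: o_def case_prod_unfold)
qed

text \<open>On an open set where \<open>c\<close> is constant, the twist is a fixed translation in the
  discrete factor.\<close>

lemma open_map_twisted:
  assumes "open_map (gtop G) X h"
    and q: "\<And>\<gamma> \<alpha>. \<lbrakk>\<gamma> \<in> carrier \<Gamma>; \<alpha> \<in> carrier \<Gamma>\<rbrakk> \<Longrightarrow> q \<gamma> \<alpha> \<in> carrier \<Gamma>"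
  shows "open_map (gtop S) (prod_topology X (discrete_topology (carrier \<Gamma>)))
    (\<lambda>(x, \<alpha>). (h x, q (c x) \<alpha>))"
  unfolding open_map_def
proof (intro allI impI)
  let ?Y = "prod_topology X (discrete_topology (carrier \<Gamma>))"
  let ?f = "\<lambda>(x, \<alpha>). (h x, q (c x) \<alpha>)"
  fix V assume V: "openin (gtop S) V"
  show "openin ?Y (?f ` V)"
  proof (subst openin_subopen, intro ballI)
    fix p assume "p \<in> ?f ` V"
    then obtain x \<alpha> where x: "(x, \<alpha>) \<in> V" and p: "p = (h x, q (c x) \<alpha>)" by auto
    then obtain U T where U: "openin (gtop G) U" "x \<in> U" and T: "\<alpha> \<in> T" "T \<subseteq> carrier \<Gamma>"
      and UT: "U \<times> T \<subseteq> V"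
      using V unfolding skew_product_simps openin_prod_topology_alt openin_discrete_topology by meson
    have xG: "x \<in> topspace (gtop G)" using U openin_subset by blast
    define U' where "U' = U \<inter> {y \<in> topspace (gtop G). c y = c x}"
    have "openin (gtop G) U'"
      unfolding U'_def using U(1) clopen_degree(1)[OF c_closed[OF xG]] by (rule openin_Int)
    then have "openin X (h ` U')"
      using assms(1) by (simp add: open_map_def)
    then have "openin ?Y (h ` U' \<times> {q (c x) \<alpha>})"
      using q c_closed[OF xG] T by (auto simp: openin_prod_Times_iff)
    moreover have "p \<in> h ` U' \<times> {q (c x) \<alpha>}"
      using p U(2) xG by (auto simp: U'_def)
    moreover have "h ` U' \<times> {q (c x) \<alpha>} \<subseteq> ?f ` V"
    proof
      fix w assume "w \<in> h ` U' \<times> {q (c x) \<alpha>}"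
      then obtain y where y: "y \<in> U" "c y = c x" "w = (h y, q (c x) \<alpha>)"
        by (auto simp: U'_def)
      then have "w = ?f (y, \<alpha>)" "(y, \<alpha>) \<in> V"
        using UT T(1) by auto
      then show "w \<in> ?f ` V" by (rule image_eqI)
    qed
    ultimately show "\<exists>T. openin ?Y T \<and> p \<in> T \<and> T \<subseteq> ?f ` V" by blast
  qed
qed

lemma compact_open_bisection_Times:
  assumes "compact_open_bisection G U" "\<alpha> \<in> carrier \<Gamma>"
  shows "compact_open_bisection S (U \<times> {\<alpha>})"
  unfolding compact_open_bisection_def
proof
  note U = compact_open_bisectionD[OF assms(1)]
  note unit = subtopology_unit_space_skew_product
  show "compactin (gtop S) (U \<times> {\<alpha>})"
    using U(2) assms(2) by (simp add: compactin_Times compactin_discrete_topology)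
  show "open_bisection S (U \<times> {\<alpha>})"
  proof (rule open_bisectionI)
    show "openin (gtop S) (U \<times> {\<alpha>})"
      using U(1) assms(2) by (simp add: openin_prod_Times_iff)
    show "inj_on (gdom S) (U \<times> {\<alpha>})"
      using U(4) by (auto simp: gdom_skew_product inj_on_def)
    show "inj_on (gran S) (U \<times> {\<alpha>})"
      using U(5) by (auto simp: gran_skew_product inj_on_def)
  next
    fix f assume "f \<in> {gdom S, gran S}"
    then consider "f = gdom S" | "f = gran S" by blast
    then show "continuous_map (gtop S) (subtopology (gtop S) (unit_space S)) f"
      using continuous_map_twisted[OF continuous_map_gdom, of "\<lambda>\<gamma> \<alpha>. \<alpha>"]
        continuous_map_twisted[OF continuous_map_gran, of "\<lambda>\<gamma> \<alpha>. \<gamma> \<otimes>\<^bsub>\<Gamma>\<^esub> \<alpha>"]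
      unfolding unit gdom_skew_product gran_skew_product by cases simp_all
  next
    fix f assume "f \<in> {gdom S, gran S}"
    then consider "f = gdom S" | "f = gran S" by blast
    then show "open_map (gtop S) (subtopology (gtop S) (unit_space S)) f"
      using open_map_twisted[OF open_map_gdom, of "\<lambda>\<gamma> \<alpha>. \<alpha>"]
        open_map_twisted[OF open_map_gran, of "\<lambda>\<gamma> \<alpha>. \<gamma> \<otimes>\<^bsub>\<Gamma>\<^esub> \<alpha>"]
      unfolding unit gdom_skew_product gran_skew_product by cases simp_all
  qed
qed

text \<open>The slice \<open>{x. (x, \<alpha>) \<in> W}\<close> alone need not be a bisection: \<open>gran S\<close> can separate
  \<open>(x, \<alpha>)\<close> from \<open>(y, \<alpha>)\<close> by the values of \<open>c\<close> although \<open>gran G x = gran G y\<close>.\<close>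

lemma compact_open_bisection_slice:
  assumes "compact_open_bisection S W" "\<alpha> \<in> carrier \<Gamma>" "\<gamma> \<in> carrier \<Gamma>"
  shows "compact_open_bisection G {x. (x, \<alpha>) \<in> W \<and> c x = \<gamma>}" (is "compact_open_bisection G ?W")
proof (rule compact_open_bisectionI)
  note W = compact_open_bisectionD[OF assms(1)]
  let ?C = "{x \<in> topspace (gtop G). c x = \<gamma>}"
  have WG: "?W \<subseteq> topspace (gtop G)"
    using W(3) by auto
  have "continuous_map (gtop G) (gtop S) (\<lambda>x. (x, \<alpha>))"
    using assms(2) by (simp add: continuous_map_pairedI)
  then have "openin (gtop G) ({x \<in> topspace (gtop G). (x, \<alpha>) \<in> W} \<inter> ?C)"
    using W(1) clopen_degree(1)[OF assms(3)] by (intro openin_Int openin_continuous_map_preimage)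
  moreover have "{x \<in> topspace (gtop G). (x, \<alpha>) \<in> W} \<inter> ?C = ?W"
    using WG by blast
  ultimately show "openin (gtop G) ?W" by simp
  \<comment> \<open>Compactness is obtained in the skew product: a closed piece of \<open>W\<close>
    is compact, and its first projection is the required set.\<close>
  have "closedin (gtop S) (?C \<times> {\<alpha>})"
    using clopen_degree(2)[OF assms(3)] assms(2) by (simp add: closedin_prod_Times_iff)
  then have "compactin (gtop S) (W \<inter> ?C \<times> {\<alpha>})"
    using W(2) by (intro compact_Int_closedin)
  then have "compactin (gtop G) (fst ` (W \<inter> ?C \<times> {\<alpha>}))"
    by (rule image_compactin) (simp add: continuous_map_fst)
  moreover have "fst ` (W \<inter> ?C \<times> {\<alpha>}) = ?W"
    using WG by force
  ultimately show "compactin (gtop G) ?W" by simp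
  show "inj_on (gdom G) ?W"
    using inj_onD[OF W(4), of "(x, \<alpha>)" "(y, \<alpha>)" for x y]
    by (auto simp: inj_on_def gdom_skew_product)
  \<comment> \<open>With both \<open>\<alpha>\<close> and the degree fixed, the second coordinates
    of \<open>gran S\<close> agree, so equal ranges in \<open>G\<close> become equal ranges in the
    skew product.\<close>
  show "inj_on (gran G) ?W"
    using inj_onD[OF W(5), of "(x, \<alpha>)" "(y, \<alpha>)" for x y]
    by (auto simp: inj_on_def gran_skew_product)
qed

text \<open>A function with finitely many degrees is the sum of its degree parts. This is the way to
  handle a slice of a bisection, whose homogeneous pieces are bisections even when the slice is
  not.\<close>

lemma steinberg_closedI_degreewise:
  assumes "finite F" "c ` {x. h x \<noteq> \<zero>} \<subseteq> F" "\<And>x. h x \<in> carrier R"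
    and "\<And>\<gamma>. \<gamma> \<in> F \<Longrightarrow> degree_part h \<gamma> \<in> carrier A"
  shows "h \<in> carrier A"
proof -
  have "(\<Oplus>\<^bsub>A\<^esub>\<gamma>\<in>F. degree_part h \<gamma>) = h"
  proof
    fix x
    have "(\<Oplus>\<^bsub>A\<^esub>\<gamma>\<in>F. degree_part h \<gamma>) x = (\<Oplus>\<gamma>\<in>F. if c x = \<gamma> then h x else \<zero>)"
      using assms by (simp add: steinberg_finsum_apply) (simp add: degree_part_def)
    also have "\<dots> = h x"
      using assms(1-3) by (intro finsum_delta) auto
    finally show "(\<Oplus>\<^bsub>A\<^esub>\<gamma>\<in>F. degree_part h \<gamma>) x = h x" .
  qed
  then show ?thesis
    using steinberg_finsum_closed[of F "degree_part h" G] assms(4) by simp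
qed

lemma skew_slice_closed:
  assumes "f \<in> carrier B" "\<alpha> \<in> carrier \<Gamma>"
  shows "(\<lambda>x. f (x, \<alpha>)) \<in> carrier A"
  using assms(1)
proof (induction rule: steinberg_induct)
  case zero
  show ?case by (rule steinberg_zero)
next
  case (add_char a W v)
  note W = compact_open_bisectionD[OF add_char(2)]
  let ?h = "\<lambda>x. char_fun R W (x, \<alpha>)"
  have "?h \<in> carrier A"
  proof (rule steinberg_closedI_degreewise)
    \<comment> \<open>The degrees met by \<open>W\<close> form the image of a compact set in a
      discrete space.\<close>
    have "compactin (gtop G) (fst ` W)"
      using W(2) by (rule image_compactin) (simp add: continuous_map_fst)
    from image_compactin[OF this grading.cocycle_continuous]
    show "finite (c ` fst ` W)" by (simp add: compactin_discrete_topology)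
    show "c ` {x. ?h x \<noteq> \<zero>} \<subseteq> c ` fst ` W"
    proof
      fix \<gamma> assume "\<gamma> \<in> c ` {x. ?h x \<noteq> \<zero>}"
      then obtain x where "\<gamma> = c x" "(x, \<alpha>) \<in> W"
        by (auto simp: char_fun_def split: if_splits)
      then show "\<gamma> \<in> c ` fst ` W"
        by (metis fst_conv imageI)
    qed
    fix \<gamma> assume "\<gamma> \<in> c ` fst ` W"
    then have "\<gamma> \<in> carrier \<Gamma>" using W(3) c_closed by auto
    moreover have "degree_part ?h \<gamma> = char_fun R {x. (x, \<alpha>) \<in> W \<and> c x = \<gamma>}"
      by (auto simp: degree_part_def char_fun_def)
    ultimately show "degree_part ?h \<gamma> \<in> carrier A"
      using compact_open_bisection_slice[OF add_char(2) assms(2)] by (simp add: steinberg_char)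
  qed simp
  with add_char show ?case by (intro steinberg_add steinberg_smult)
qed

lemma finite_skew_support: "f \<in> carrier B \<Longrightarrow> finite (snd ` {p. f p \<noteq> \<zero>})"
proof (induction rule: steinberg_induct)
  case (add_char a W v)
  have "continuous_map (gtop S) (discrete_topology (carrier \<Gamma>)) snd"
    by (simp add: continuous_map_snd)
  from image_compactin[OF compact_open_bisectionD(2)[OF add_char(2)] this]
  have "finite (snd ` W)" by (simp add: compactin_discrete_topology)
  moreover have "snd ` {p. a \<otimes> char_fun R W p \<oplus> v p \<noteq> \<zero>} \<subseteq> snd ` W \<union> snd ` {p. v p \<noteq> \<zero>}"
    using add_char(1) by (auto simp: char_fun_def)
  ultimately show ?case
    using add_char(4) finite_subset by blast
qed simp

text \<open>Placing a function on the sheet at \<open>\<alpha>\<close> turns the generator of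
  \<open>U\<close> into that of \<open>U \<times> {\<alpha>}\<close>. Finite sums of such functions
  give the inverse of slicing.\<close>

lemma skew_monomial_closed:
  assumes "h \<in> carrier A" "\<alpha> \<in> carrier \<Gamma>"
  shows "(\<lambda>p. if snd p = \<alpha> then h (fst p) else \<zero>) \<in> carrier B"
  using assms(1)
proof (induction rule: steinberg_induct)
  case zero
  show ?case using steinberg_zero by simp
next
  case (add_char a U v)
  have "(\<lambda>p. if snd p = \<alpha> then a \<otimes> char_fun R U (fst p) \<oplus> v (fst p) else \<zero>)
      = (\<lambda>p. a \<otimes> char_fun R (U \<times> {\<alpha>}) p \<oplus> (if snd p = \<alpha> then v (fst p) else \<zero>))"
    using add_char(1) by (intro ext) (auto simp: char_fun_def split_beta mem_Times_iff)
  then show ?case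
    using steinberg_add_char[OF add_char(1) compact_open_bisection_Times[OF add_char(2) assms(2)]
      add_char(4)] by simp
qed

lemma skew_finite_sum_closed:
  assumes "finite F" "\<And>\<alpha>. \<alpha> \<in> F \<Longrightarrow> \<alpha> \<in> carrier \<Gamma> \<and> r \<alpha> \<in> carrier A"
  shows "(\<lambda>p. if snd p \<in> F then r (snd p) (fst p) else \<zero>) \<in> carrier B"
  using assms
proof (induction F)
  case empty
  then show ?case using steinberg_zero by simp
next
  case (insert \<alpha> F)
  have "r \<alpha> \<in> carrier A" using insert.prems by simp
  note closed = steinberg_closed[OF this]
  have closed': "r \<beta> x \<in> carrier R" if "\<beta> \<in> F" for \<beta> x
    using insert.prems that by (intro steinberg_closed[of _ G]) simp
  have "(\<lambda>p. (if snd p = \<alpha> then r \<alpha> (fst p) else \<zero>)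
        \<oplus> (if snd p \<in> F then r (snd p) (fst p) else \<zero>)) \<in> carrier B"
    using insert by (intro steinberg_add skew_monomial_closed) auto
  moreover have "(\<lambda>p. (if snd p = \<alpha> then r \<alpha> (fst p) else \<zero>)
        \<oplus> (if snd p \<in> F then r (snd p) (fst p) else \<zero>))
      = (\<lambda>p. if snd p \<in> insert \<alpha> F then r (snd p) (fst p) else \<zero>)"
    using insert(2) closed closed' by (intro ext) auto
  ultimately show ?case by simp
qed

text \<open>The right factor of \<open>(z, \<beta>)\<close> has second coordinate
  \<open>\<beta>\<close>, and the left one is then forced. Indexing by the right factors of a slice
  of \<open>g\<close> takes finiteness from \<open>G\<close>.\<close>

lemma convolution_skew:
  assumes f: "f \<in> carrier B" and g: "g \<in> carrier B" and \<beta>: "\<beta> \<in> carrier \<Gamma>"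
  shows "convolution R S f g (z, \<beta>) =
    (\<Oplus>y\<in>right_factors (\<lambda>x. g (x, \<beta>)) z.
      f (gmult G z (ginv G y), c y \<otimes>\<^bsub>\<Gamma>\<^esub> \<beta>) \<otimes> g (y, \<beta>))"
proof (rule convolution_finsum)
  let ?K = "right_factors (\<lambda>x. g (x, \<beta>)) z"
  show "finite ?K"
    using finite_right_factors[OF skew_slice_closed[OF g \<beta>]] .
  show "inj_on (\<lambda>y. (y, \<beta>)) ?K"
    by (simp add: inj_on_def)
next
  fix y assume "y \<in> right_factors (\<lambda>x. g (x, \<beta>)) z"
  then obtain x where x: "gcomposable G x y" "gmult G x y = z"
    by (auto simp: right_factors_def)
  then have "gmult G z (ginv G y) = x" using mult_inv_cancel by force
  then show "gcomposable S (gmult G z (ginv G y), c y \<otimes>\<^bsub>\<Gamma>\<^esub> \<beta>) (y, \<beta>)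
      \<and> gmult S (gmult G z (ginv G y), c y \<otimes>\<^bsub>\<Gamma>\<^esub> \<beta>) (y, \<beta>) = (z, \<beta>)"
    using x \<beta> c_closed composableD(2) by simp
next
  fix p q assume "gcomposable S p q" "gmult S p q = (z, \<beta>)" "g q \<noteq> \<zero>"
  then obtain x y where "p = (x, c y \<otimes>\<^bsub>\<Gamma>\<^esub> \<beta>)" "q = (y, \<beta>)"
    and xy: "gcomposable G x y" "gmult G x y = z" "g (y, \<beta>) \<noteq> \<zero>"
    by (cases p; cases q) auto
  moreover have "gmult G z (ginv G y) = x" using mult_inv_cancel xy by force
  moreover have "y \<in> right_factors (\<lambda>x. g (x, \<beta>)) z"
    using xy by (auto simp: right_factors_def)
  ultimately show "\<exists>y\<in>right_factors (\<lambda>x. g (x, \<beta>)) z.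
      p = (gmult G z (ginv G y), c y \<otimes>\<^bsub>\<Gamma>\<^esub> \<beta>) \<and> q = (y, \<beta>)"
    by (intro bexI[of _ y]) simp_all
qed (use steinberg_closed[OF f] steinberg_closed[OF g] in auto)

end

subsection \<open>The isomorphism\<close>

context graded_steinberg
begin

abbreviation C where "C \<equiv> smash_product \<Gamma> A (steinberg_grading R G c)"

definition slices :: "('g \<times> 'h \<Rightarrow> 'r) \<Rightarrow> 'h \<Rightarrow> 'g \<Rightarrow> 'r"
  where "slices f = (\<lambda>\<alpha> x. f (x, \<alpha>))"

lemma slices_outside:
  assumes "f \<in> carrier B" "\<alpha> \<notin> carrier \<Gamma>"
  shows "slices f \<alpha> = (\<lambda>x. \<zero>)"
  using steinberg_outside[OF assms(1)] assms(2) by (simp add: slices_def)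

lemma finite_slices_support:
  assumes "f \<in> carrier B"
  shows "finite {\<alpha>. slices f \<alpha> \<noteq> (\<lambda>x. \<zero>)}"
proof (rule finite_subset)
  show "{\<alpha>. slices f \<alpha> \<noteq> (\<lambda>x. \<zero>)} \<subseteq> snd ` {p. f p \<noteq> \<zero>}"
  proof
    fix \<alpha> assume "\<alpha> \<in> {\<alpha>. slices f \<alpha> \<noteq> (\<lambda>x. \<zero>)}"
    then obtain x where "f (x, \<alpha>) \<noteq> \<zero>" by (auto simp: slices_def fun_eq_iff)
    then show "\<alpha> \<in> snd ` {p. f p \<noteq> \<zero>}" by (intro image_eqI[of _ _ "(x, \<alpha>)"]) simp_all
  qed
qed (rule finite_skew_support[OF assms])

lemma carrier_smash:
  "r \<in> carrier C \<longleftrightarrow> (\<forall>\<gamma>\<in>carrier \<Gamma>. r \<gamma> \<in> carrier A) \<and> (\<forall>\<gamma>. \<gamma> \<notin> carrier \<Gamma> \<longrightarrow> r \<gamma> = (\<lambda>x. \<zero>))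
    \<and> finite {\<gamma>. r \<gamma> \<noteq> (\<lambda>x. \<zero>)}"
  by (simp add: smash_product_def)

lemma slices_closed: "f \<in> carrier B \<Longrightarrow> slices f \<in> carrier C"
  unfolding carrier_smash
  using slices_outside finite_slices_support skew_slice_closed by (auto simp: slices_def)

lemma slices_surj:
  assumes r: "r \<in> carrier C"
  shows "(\<lambda>p. r (snd p) (fst p)) \<in> carrier B"
proof -
  let ?F = "{\<gamma>. r \<gamma> \<noteq> (\<lambda>x. \<zero>)}"
  have "(\<lambda>p. if snd p \<in> ?F then r (snd p) (fst p) else \<zero>) \<in> carrier B"
    using r unfolding carrier_smash by (intro skew_finite_sum_closed) auto
  moreover have "(\<lambda>p. if snd p \<in> ?F then r (snd p) (fst p) else \<zero>) = (\<lambda>p. r (snd p) (fst p))"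
    by auto
  ultimately show ?thesis by simp
qed

lemma bij_betw_slices: "bij_betw slices (carrier B) (carrier C)"
proof (rule bij_betw_byWitness[where f' = "\<lambda>r p. r (snd p) (fst p)"])
  show "slices ` carrier B \<subseteq> carrier C" using slices_closed by blast
  show "(\<lambda>r p. r (snd p) (fst p)) ` carrier C \<subseteq> carrier B" using slices_surj by blast
qed (simp_all add: slices_def)

text \<open>The smash product expands to a double sum over the nonzero slices of \<open>f\<close>
  and the right factors \<open>y\<close> for the slice of \<open>g\<close>. Summing over \<alpha>
  first leaves one term per \<open>y\<close>, and the result is the convolution in the skew
  product.\<close>

lemma slices_mult:
  assumes f: "f \<in> carrier B" and g: "g \<in> carrier B"
  shows "slices (convolution R S f g) = slices f \<otimes>\<^bsub>C\<^esub> slices g"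
proof (intro ext)
  fix \<beta> z
  note closed = steinberg_closed[OF f] steinberg_closed[OF g]
  show "slices (convolution R S f g) \<beta> z = (slices f \<otimes>\<^bsub>C\<^esub> slices g) \<beta> z"
  proof (cases "\<beta> \<in> carrier \<Gamma>")
    case False
    then have "\<not> (gcomposable S p q \<and> gmult S p q = (z, \<beta>))" for p q
      by (cases p; cases q) auto
    then have "convolution R S f g (z, \<beta>) = (\<Oplus>k\<in>{}. f k \<otimes> g k)"
      by (intro convolution_finsum closed) auto
    with False show ?thesis
      by (simp add: slices_def smash_product_def)
  next
    case \<beta>: True
    let ?F = "{\<alpha>. slices f \<alpha> \<noteq> (\<lambda>x. \<zero>)}"
    let ?g = "slices g \<beta>"
    let ?K = "right_factors ?g z"
    let ?d = "\<lambda>\<alpha>. degree_part ?g (\<alpha> \<otimes>\<^bsub>\<Gamma>\<^esub> inv\<^bsub>\<Gamma>\<^esub> \<beta>)"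
    let ?x = "\<lambda>y. gmult G z (ginv G y)"
    have gA: "?g \<in> carrier A"
      using skew_slice_closed[OF g \<beta>] by (simp add: slices_def)
    have F: "\<alpha> \<in> carrier \<Gamma>" "slices f \<alpha> \<in> carrier A" "\<alpha> \<otimes>\<^bsub>\<Gamma>\<^esub> inv\<^bsub>\<Gamma>\<^esub> \<beta> \<in> carrier \<Gamma>" "?d \<alpha> \<in> carrier A"
      if "\<alpha> \<in> ?F" for \<alpha>
    proof -
      show \<alpha>: "\<alpha> \<in> carrier \<Gamma>" using slices_outside[OF f] that by blast
      then show "slices f \<alpha> \<in> carrier A" using skew_slice_closed[OF f] by (simp add: slices_def)
      show *: "\<alpha> \<otimes>\<^bsub>\<Gamma>\<^esub> inv\<^bsub>\<Gamma>\<^esub> \<beta> \<in> carrier \<Gamma>"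
        using \<alpha> \<beta> by simp
      show "?d \<alpha> \<in> carrier A"
        using gA * by (rule degree_part_closed)
    qed
    have K: "finite ?K" "y \<in> ?K \<Longrightarrow> y \<in> topspace (gtop G)" for y
      using finite_right_factors[OF gA] composableD(2) by (auto simp: right_factors_def)
    have "(slices f \<otimes>\<^bsub>C\<^esub> slices g) \<beta>
        = (\<Oplus>\<^bsub>A\<^esub>\<alpha>\<in>?F. slices f \<alpha> \<otimes>\<^bsub>A\<^esub> homogeneous_component \<Gamma> A (steinberg_grading R G c) ?g
            (\<alpha> \<otimes>\<^bsub>\<Gamma>\<^esub> inv\<^bsub>\<Gamma>\<^esub> \<beta>))"
      using \<beta> by (simp add: smash_product_def)
    also have "\<dots> = (\<Oplus>\<^bsub>A\<^esub>\<alpha>\<in>?F. convolution R G (slices f \<alpha>) (?d \<alpha>))"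
      using F convolution_closed homogeneous_component_eq[OF gA]
      by (intro abelian_monoid.finsum_cong'[OF steinberg_abelian_monoid]) auto
    finally have "(slices f \<otimes>\<^bsub>C\<^esub> slices g) \<beta> z
        = (\<Oplus>\<^bsub>A\<^esub>\<alpha>\<in>?F. convolution R G (slices f \<alpha>) (?d \<alpha>)) z" by simp
    also have "\<dots> = (\<Oplus>\<alpha>\<in>?F. convolution R G (slices f \<alpha>) (?d \<alpha>) z)"
      using F convolution_closed finite_slices_support[OF f] by (intro steinberg_finsum_apply) auto
    \<comment> \<open>Right factors for a degree part are right factors for the whole slice, so
      \<open>?K\<close> serves every \<alpha> and the sums can be exchanged.\<close>
    also have "\<dots> = (\<Oplus>\<alpha>\<in>?F. \<Oplus>y\<in>?K. f (?x y, \<alpha>) \<otimes> ?d \<alpha> y)"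
    proof (rule finsum_cong')
      fix \<alpha> assume \<alpha>: "\<alpha> \<in> ?F"
      have "convolution R G (slices f \<alpha>) (?d \<alpha>) z = (\<Oplus>y\<in>?K. slices f \<alpha> (?x y) \<otimes> ?d \<alpha> y)"
      proof (rule convolution_right_factors)
        show "right_factors (?d \<alpha>) z \<subseteq> ?K"
          by (auto simp: right_factors_def degree_part_def split: if_splits)
        show "\<exists>x. gcomposable G x y \<and> gmult G x y = z" if "y \<in> ?K" for y
          using that by (simp add: right_factors_def)
      qed (use K(1) steinberg_closed[OF F(2)[OF \<alpha>]] steinberg_closed[OF F(4)[OF \<alpha>]] in auto)
      then show "convolution R G (slices f \<alpha>) (?d \<alpha>) z = (\<Oplus>y\<in>?K. f (?x y, \<alpha>) \<otimes> ?d \<alpha> y)"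
        by (simp add: slices_def)
    next
      show "(\<lambda>\<alpha>. \<Oplus>y\<in>?K. f (?x y, \<alpha>) \<otimes> ?d \<alpha> y) \<in> ?F \<rightarrow> carrier R"
        using closed(1) steinberg_closed[OF F(4)] by (intro funcsetI finsum_closed m_closed) auto
    qed simp
    also have "\<dots> = (\<Oplus>y\<in>?K. \<Oplus>\<alpha>\<in>?F. f (?x y, \<alpha>) \<otimes> ?d \<alpha> y)"
      using finite_slices_support[OF f] K(1) closed(1) steinberg_closed[OF F(4)]
      by (intro finsum_swap m_closed) auto
    also have "\<dots> = (\<Oplus>y\<in>?K. f (?x y, c y \<otimes>\<^bsub>\<Gamma>\<^esub> \<beta>) \<otimes> g (y, \<beta>))"
    proof (rule finsum_cong')
      fix y assume y: "y \<in> ?K"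
      have "(\<Oplus>\<alpha>\<in>?F. f (?x y, \<alpha>) \<otimes> ?d \<alpha> y)
          = (\<Oplus>\<alpha>\<in>?F. if c y \<otimes>\<^bsub>\<Gamma>\<^esub> \<beta> = \<alpha> then f (?x y, \<alpha>) \<otimes> g (y, \<beta>) else \<zero>)"
      proof (rule finsum_cong')
        fix \<alpha> assume "\<alpha> \<in> ?F"
        \<comment> \<open>The degree condition of the smash product is thus the composability
          condition of the skew product.\<close>
        then have "c y = \<alpha> \<otimes>\<^bsub>\<Gamma>\<^esub> inv\<^bsub>\<Gamma>\<^esub> \<beta> \<longleftrightarrow> c y \<otimes>\<^bsub>\<Gamma>\<^esub> \<beta> = \<alpha>"
          using F(1) \<beta> c_closed[OF K(2)[OF y]] by (auto simp: grading.inv_solve_right)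
        then show "f (?x y, \<alpha>) \<otimes> ?d \<alpha> y
            = (if c y \<otimes>\<^bsub>\<Gamma>\<^esub> \<beta> = \<alpha> then f (?x y, \<alpha>) \<otimes> g (y, \<beta>) else \<zero>)"
          using closed by (simp add: degree_part_def slices_def)
      qed (use closed in auto)
      also have "\<dots> = f (?x y, c y \<otimes>\<^bsub>\<Gamma>\<^esub> \<beta>) \<otimes> g (y, \<beta>)"
      proof (rule finsum_delta)
        \<comment> \<open>If the selected index is missing from the sum, the slice of
          \<open>f\<close> at it is zero, so the term it would contribute vanishes.\<close>
        assume "c y \<otimes>\<^bsub>\<Gamma>\<^esub> \<beta> \<notin> ?F"
        then have "f (?x y, c y \<otimes>\<^bsub>\<Gamma>\<^esub> \<beta>) = \<zero>"
          by (simp add: slices_def fun_eq_iff)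
        then show "f (?x y, c y \<otimes>\<^bsub>\<Gamma>\<^esub> \<beta>) \<otimes> g (y, \<beta>) = \<zero>"
          using closed by simp
      qed (use closed finite_slices_support[OF f] in auto)
      finally show "(\<Oplus>\<alpha>\<in>?F. f (?x y, \<alpha>) \<otimes> ?d \<alpha> y) = f (?x y, c y \<otimes>\<^bsub>\<Gamma>\<^esub> \<beta>) \<otimes> g (y, \<beta>)" .
    qed (use closed in auto)
    also have "\<dots> = slices (convolution R S f g) \<beta> z"
      using convolution_skew[OF f g \<beta>] by (simp add: slices_def)
    finally show ?thesis by simp
  qed
qed

lemma slices_grading:
  assumes "\<gamma> \<in> carrier \<Gamma>"
  shows "slices ` steinberg_grading R S (\<lambda>(x, \<alpha>). c x) \<gamma> = smash_grading \<Gamma> A (steinberg_grading R G c) \<gamma>"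
proof (intro equalityI subsetI)
  fix r assume "r \<in> slices ` steinberg_grading R S (\<lambda>(x, \<alpha>). c x) \<gamma>"
  then obtain f where r: "r = slices f" and "f \<in> steinberg_grading R S (\<lambda>(x, \<alpha>). c x) \<gamma>"
    by blast
  then have f: "f \<in> carrier B" and deg: "f (x, \<alpha>) \<noteq> \<zero> \<Longrightarrow> c x = \<gamma>" for x \<alpha>
    by (auto simp: steinberg_grading_iff)
  have "r \<alpha> \<in> steinberg_grading R G c \<gamma>" if "\<alpha> \<in> carrier \<Gamma>" for \<alpha>
    using skew_slice_closed[OF f that] deg by (auto simp: r slices_def steinberg_grading_iff)
  with slices_closed[OF f] show "r \<in> smash_grading \<Gamma> A (steinberg_grading R G c) \<gamma>"
    by (simp add: r smash_grading_def)
next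
  fix r assume "r \<in> smash_grading \<Gamma> A (steinberg_grading R G c) \<gamma>"
  then have r: "r \<in> carrier C" and deg: "\<And>\<alpha>. \<alpha> \<in> carrier \<Gamma> \<Longrightarrow> r \<alpha> \<in> steinberg_grading R G c \<gamma>"
    by (simp_all add: smash_grading_def)
  have "c x = \<gamma>" if "r \<alpha> x \<noteq> \<zero>" for \<alpha> x
    using that r deg[of \<alpha>] by (cases "\<alpha> \<in> carrier \<Gamma>") (auto simp: carrier_smash steinberg_grading_iff)
  then have "(\<lambda>p. r (snd p) (fst p)) \<in> steinberg_grading R S (\<lambda>(x, \<alpha>). c x) \<gamma>"
    using slices_surj[OF r] by (auto simp: steinberg_grading_iff)
  moreover have "r = slices (\<lambda>p. r (snd p) (fst p))"
    by (simp add: slices_def)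
  ultimately show "r \<in> slices ` steinberg_grading R S (\<lambda>(x, \<alpha>). c x) \<gamma>" by blast
qed

lemma slices_iso:
  "graded_algebra_iso \<Gamma> R B (steinberg_grading R S (\<lambda>(x, \<alpha>). c x)) C
    (smash_grading \<Gamma> A (steinberg_grading R G c)) slices"
  unfolding graded_algebra_iso_def
proof (intro conjI ballI)
  fix f g assume "f \<in> carrier B" "g \<in> carrier B"
  then show "slices (f \<otimes>\<^bsub>B\<^esub> g) = slices f \<otimes>\<^bsub>C\<^esub> slices g"
    by (simp add: slices_mult)
qed (simp_all add: bij_betw_slices slices_grading, simp_all add: slices_def smash_product_def)

lemma slices_char: "slices (char_fun R (U \<times> {\<alpha>})) = smash_monomial A (char_fun R U) \<alpha>"
  by (auto simp: slices_def smash_monomial_def char_fun_def fun_eq_iff)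

end

theorem theorem3p4:
  fixes \<Gamma> :: "('h, 'n) monoid_scheme"
    and G :: "('g, 'm) top_groupoid_scheme"
    and c :: "'g \<Rightarrow> 'h"
    and R :: "('r, 'k) ring_scheme"
  assumes "group \<Gamma>"
    and "ample_groupoid G" and "Hausdorff_space (gtop G)"
    and "groupoid_grading \<Gamma> G c"
    and "cring R"
  shows "\<exists>\<phi>.
    graded_algebra_iso \<Gamma> R
      (steinberg_algebra R (skew_product \<Gamma> G c))
      (steinberg_grading R (skew_product \<Gamma> G c) (\<lambda>(x, \<alpha>). c x))
      (smash_product \<Gamma> (steinberg_algebra R G) (steinberg_grading R G c))
      (smash_grading \<Gamma> (steinberg_algebra R G) (steinberg_grading R G c))
      \<phi>
    \<and> (\<forall>U. \<forall>\<alpha> \<in> carrier \<Gamma>. compact_open_bisection G U \<longrightarrow>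
        \<phi> (char_fun R (U \<times> {\<alpha>})) = smash_monomial (steinberg_algebra R G) (char_fun R U) \<alpha>)"
proof -
  interpret graded_steinberg R \<Gamma> G c
    using assms by (simp add: graded_steinberg_def hausdorff_steinberg_def
        hausdorff_steinberg_axioms_def ample_groupoid_def)
  show ?thesis
    using slices_iso slices_char by blast
qed

end
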